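(* Let $n>1$, let $B=\{x\in\mathbb{R}^n:|x|\le1\}$ be the Euclidean unit ball and let $r>0$. Suppose that every set $\Lambda\subset\mathbb{R}^n$ satisfying $(\Lambda-\Lambda)\cap rB=\{0\}$ is an interpolation set for $PW_B$. Then $$r>\frac{2\pi}{|B|^{2/n}},$$ where $\dfrac{2\pi}{|B|^{2/n}}=\dfrac{n}{e}(1+o(1))$ as $n\to\infty$.
   Context: $|B|$ denotes the Lebesgue measure of $B$ and $\Lambda-\Lambda=\{\lambda-\lambda':\lambda,\lambda'\in\Lambda\}$. For a bounded set $S\subset\mathbb{R}^n$ of positive measure, the Paley--Wiener space $PW_S$ consists of all Fourier transforms $\hat F(t)=(2\pi)^{-n/2}\int_{\mathbb{R}^n}e^{-it\cdot x}F(x)\,dx$ of functions $F\in L^2(\mathbb{R}^n)$ vanishing a.e. outside $S$ (its elements are continuous functions). A countable set $\Lambda$ is an interpolation set for $PW_S$ if for every $c\in\ell^2(\Lambda)$ there is $f\in PW_S$ with $f(\lambda)=c(\lambda)$ for all $\lambda\in\Lambda$. *)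

theory Defs
  imports "HOL-Analysis.Analysis"
begin

definition fourier_transform :: "(real ^ 'n \<Rightarrow> complex) \<Rightarrow> real ^ 'n \<Rightarrow> complex" where
  "fourier_transform F t =
     (2 * pi) powr (- (real CARD('n) / 2)) *\<^sub>R
       (LINT x|lborel. exp (- (\<i> * complex_of_real (t \<bullet> x))) * F x)"

definition square_integrable :: "(real ^ 'n \<Rightarrow> complex) \<Rightarrow> bool" where
  "square_integrable F \<longleftrightarrow>
     F \<in> borel_measurable lborel \<and> integrable lborel (\<lambda>x. (norm (F x))\<^sup>2)"

(* Intended for bounded S: then F is integrable, so the integral defining its Fourier
   transform converges absolutely at every point and pointwise values are meaningful. *)
definition paley_wiener :: "(real ^ 'n) set \<Rightarrow> (real ^ 'n \<Rightarrow> complex) set" where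
  "paley_wiener S =
     {fourier_transform F | F. square_integrable F \<and> (AE x in lborel. x \<notin> S \<longrightarrow> F x = 0)}"

(* Elements of l^2(\<Lambda>) are represented by functions on the whole space, of which only the
   values on \<Lambda> matter. *)
definition interpolation_set :: "(real ^ 'n) set \<Rightarrow> (real ^ 'n) set \<Rightarrow> bool" where
  "interpolation_set S \<Lambda> \<longleftrightarrow>
     countable \<Lambda> \<and>
     (\<forall>c :: real ^ 'n \<Rightarrow> complex. (\<lambda>l. (norm (c l))\<^sup>2) summable_on \<Lambda> \<longrightarrow>
        (\<exists>f \<in> paley_wiener S. \<forall>l\<in>\<Lambda>. f l = c l))"

definition difference_set :: "(real ^ 'n) set \<Rightarrow> (real ^ 'n) set" where
  "difference_set \<Lambda> = {x - y | x y. x \<in> \<Lambda> \<and> y \<in> \<Lambda>}"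

(* The volume |B| of the n-dimensional unit ball as a function of n :: nat, needed for the
   limit n \<rightarrow> \<infinity>, in which the dimension cannot be a type. *)
definition unit_ball_volume :: "nat \<Rightarrow> real" where
  "unit_ball_volume n =
     measure (Pi\<^sub>M {..<n} (\<lambda>_. lborel))
       {x \<in> space (Pi\<^sub>M {..<n} (\<lambda>_. lborel)). sqrt (\<Sum>i<n. (x i)\<^sup>2) \<le> (1::real)}"

lemma unit_ball_volume_eq_measure_cball:
  "unit_ball_volume CARD('n) = measure lborel (cball 0 1 :: (real ^ 'n) set)"
proof -
  let ?M = "Pi\<^sub>M {..<CARD('n)} (\<lambda>_. lborel :: real measure)"
  have "{x \<in> space ?M. sqrt (\<Sum>i<CARD('n). (x i)\<^sup>2) \<le> 1} =
        {f. sqrt (\<Sum>i<CARD('n). (f i)\<^sup>2) \<le> 1} \<inter> space ?M"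
    by auto
  moreover have "emeasure ?M ({f. sqrt (\<Sum>i<CARD('n). (f i)\<^sup>2) \<le> 1} \<inter> space ?M) =
        emeasure lborel (cball 0 1 :: (real ^ 'n) set)"
    using emeasure_cball_aux[of "{..<CARD('n)}" 1] emeasure_cball[of 1 "0 :: real ^ 'n"]
    by simp
  ultimately show ?thesis
    by (simp add: unit_ball_volume_def measure_def)
qed

end

theory Submission
  imports Defs
begin

text \<open>
  Write \<open>V\<close> for the volume of the unit ball and suppose that every set whose distinct points are more
  than \<open>r\<close> apart is an interpolation set. It is enough to test one set \<open>\<Lambda> = L(U + \<int>\<^sup>n)\<close>, periodic with
  period \<open>L = 4r\<close>, where \<open>U\<close> is a finite subset of the unit cell. Two estimates of \<open>N = card U\<close> are
  compared.

  From below (\<open>dense_periodic_packing\<close>): if \<open>U\<close> is maximal, the balls of radius \<open>r\<close> around \<open>\<Lambda>\<close> cover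
  space, so their volume per period, \<open>N V r\<^sup>n\<close>, is at least \<open>L\<^sup>n\<close>. The maximal set is chosen among those
  that contain two prescribed points at distance \<open>3r/2\<close>. Their balls overlap in a set of positive
  measure, hence \<open>N V r\<^sup>n > L\<^sup>n\<close>; this is the source of the strict inequality in the theorem.

  From above (\<open>card_le_measure_of_biorthogonal_waves\<close>): for each \<open>u \<in> U\<close> interpolate the data that are
  \<open>1\<close> at \<open>Lu\<close> and \<open>0\<close> elsewhere on \<open>\<Lambda>\<close>. For periodic \<open>\<Lambda>\<close> the prescribed values of \<open>f\<close> are Fourier
  coefficients on the torus \<open>\<real>\<^sup>n/\<int>\<^sup>n\<close>: with \<open>f\<close> the transform of \<open>G\<close>, in rescaled coordinates,
  \<open>f(v + l)\<close> is the \<open>l\<close>-th coefficient of the periodic function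
  \<open>y \<mapsto> \<Sum>\<^sub>k exp(-2\<pi>i v\<bullet>(y + k)) G(y + k)\<close>.
  Fourier coefficients determine a function almost everywhere
  (\<open>fourier_coeff_unique_unit_cell\<close>), so for almost every \<open>y\<close> the \<open>N\<close> vectors
  \<open>(exp(-2\<pi>i v\<bullet>(y + k)))\<^sub>k\<close> are biorthogonal to the \<open>N\<close> vectors \<open>(G\<^sub>u(y + k))\<^sub>k\<close>. These live on the
  \<open>k\<close> for which \<open>y + k\<close> lies in the rescaled ball, so there are at least \<open>N\<close> such \<open>k\<close>. Integrating over
  \<open>y\<close> gives \<open>N \<le> V (L/2\<pi>)\<^sup>n\<close>.

  Together, \<open>V\<^sup>2 (r/2\<pi>)\<^sup>n > 1\<close>, which is the asserted bound. Its asymptotics follow from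
  \<open>2\<pi>/V\<^bsup>2/n\<^esup> = 2 \<Gamma>(n/2 + 1)\<^bsup>2/n\<^esup>\<close> and a weak form of Stirling's formula, in which
  \<open>ln \<Gamma>(x + 1) - (x ln x - x)\<close> is only shown to grow at most logarithmically.
\<close>

section \<open>The integer lattice and integration over a period\<close>

text \<open>
  Half-open, so that the lattice translates tile space exactly and no boundary has to be discarded.
\<close>
definition unit_cell :: "(real ^ 'n) set" where
  "unit_cell = {x. \<forall>i. 0 \<le> x $ i \<and> x $ i < 1}"

definition int_lattice :: "(real ^ 'n) set" where
  "int_lattice = {k. \<forall>i. k $ i \<in> \<int>}"

lemma zero_in_int_lattice: "0 \<in> int_lattice"
  by (simp add: int_lattice_def)

lemma uminus_in_int_lattice: "k \<in> int_lattice \<Longrightarrow> - k \<in> int_lattice"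
  by (simp add: int_lattice_def)

lemma add_in_int_lattice: "k \<in> int_lattice \<Longrightarrow> l \<in> int_lattice \<Longrightarrow> k + l \<in> int_lattice"
  by (simp add: int_lattice_def)

lemma diff_in_int_lattice: "k \<in> int_lattice \<Longrightarrow> l \<in> int_lattice \<Longrightarrow> k - l \<in> int_lattice"
  by (simp add: int_lattice_def)

lemma unit_cell_representative:
  fixes x :: "real ^ 'n"
  obtains k where "k \<in> int_lattice" "x - k \<in> unit_cell"
proof
  show "(\<chi> i. real_of_int \<lfloor>x $ i\<rfloor>) \<in> int_lattice"
    by (simp add: int_lattice_def)
  show "x - (\<chi> i. real_of_int \<lfloor>x $ i\<rfloor>) \<in> unit_cell"
    by (simp add: unit_cell_def) linarith
qed

lemma int_lattice_norm_ge_1: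
  assumes "k \<in> int_lattice" "k \<noteq> 0" shows "1 \<le> norm k"
proof -
  obtain i where "k $ i \<noteq> 0" using assms(2) by (auto simp: vec_eq_iff)
  moreover have "k $ i \<in> \<int>" using assms(1) by (simp add: int_lattice_def)
  ultimately have "1 \<le> \<bar>k $ i\<bar>" by (auto elim!: Ints_cases)
  then show ?thesis using component_le_norm_cart[of k i] by linarith
qed

lemma unit_cell_representative_unique:
  assumes "x \<in> unit_cell" "x + k \<in> unit_cell" "k \<in> int_lattice" shows "k = 0"
proof -
  have "k $ i = 0" for i
  proof -
    have "k $ i \<in> \<int>" "0 \<le> x $ i" "x $ i < 1" "0 \<le> x $ i + k $ i" "x $ i + k $ i < 1"
      using assms by (auto simp: unit_cell_def int_lattice_def)
    then show ?thesis by (auto elim!: Ints_cases)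
  qed
  then show ?thesis by (simp add: vec_eq_iff)
qed

lemma finite_int_lattice_cball: "finite {k \<in> int_lattice. norm (k :: real ^ 'n) \<le> R}"
proof -
  let ?A = "{k \<in> int_lattice. norm (k :: real ^ 'n) \<le> R}"
  obtain m :: int where m: "R \<le> m" using ex_le_of_int by blast
  let ?I = "real_of_int ` {-m..m}"
  have "finite (PiE (UNIV :: 'n set) (\<lambda>_. ?I))"
    by (intro finite_PiE) auto
  then have "finite (vec_lambda ` PiE (UNIV :: 'n set) (\<lambda>_. ?I))" by blast
  moreover have "?A \<subseteq> vec_lambda ` PiE (UNIV :: 'n set) (\<lambda>_. ?I)"
  proof
    fix k :: "real ^ 'n" assume k: "k \<in> ?A"
    have "k $ i \<in> ?I" for i
    proof -
      obtain j where j: "k $ i = real_of_int j"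
        using k by (auto simp: int_lattice_def elim: Ints_cases)
      have "\<bar>k $ i\<bar> \<le> m" using component_le_norm_cart[of k i] k m by auto
      then show ?thesis using j by (intro image_eqI[of _ _ j]) auto
    qed
    then show "k \<in> vec_lambda ` PiE (UNIV :: 'n set) (\<lambda>_. ?I)"
      by (intro image_eqI[of _ _ "vec_nth k"]) auto
  qed
  ultimately show ?thesis using finite_subset by blast
qed

lemma unit_cell_measurable [measurable]: "unit_cell \<in> sets (borel :: (real ^ 'n) measure)"
  unfolding unit_cell_def by measurable

lemma unit_cell_subset_cbox: "unit_cell \<subseteq> cbox 0 (1 :: real ^ 'n)"
  by (auto simp: unit_cell_def mem_box_cart less_imp_le)

lemma norm_le_card_of_unit_cell: "x \<in> unit_cell \<Longrightarrow> norm (x :: real ^ 'n) \<le> CARD('n)"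
  using norm_le_l1_cart[of x] sum_bounded_above[of UNIV "\<lambda>i. \<bar>x $ i\<bar>" 1]
  by (auto simp: unit_cell_def less_imp_le)

lemma emeasure_unit_cell: "emeasure lborel (unit_cell :: (real ^ 'n) set) = 1"
proof (rule antisym)
  have "(\<Prod>b\<in>Basis. (1 :: real ^ 'n) \<bullet> b) = 1"
    by (rule prod.neutral) (auto simp: Basis_vec_def inner_axis)
  then have 1: "emeasure lborel (cbox 0 1 :: (real ^ 'n) set) = 1"
    "emeasure lborel (box 0 1 :: (real ^ 'n) set) = 1"
    by (auto simp: emeasure_lborel_cbox_eq emeasure_lborel_box_eq Basis_vec_def inner_axis
        simp del: prod_constant)
  show "emeasure lborel (unit_cell :: (real ^ 'n) set) \<le> 1"
    using emeasure_mono[of unit_cell "cbox 0 1 :: (real ^ 'n) set" lborel] unit_cell_subset_cbox 1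
    by simp
  have "box 0 1 \<subseteq> (unit_cell :: (real ^ 'n) set)"
    by (auto simp: unit_cell_def mem_box_cart less_imp_le)
  then show "1 \<le> emeasure lborel (unit_cell :: (real ^ 'n) set)"
    using emeasure_mono[of "box 0 1" "unit_cell :: (real ^ 'n) set" lborel] 1 by simp
qed

lemma lborel_shift:
  fixes f :: "real ^ 'n \<Rightarrow> 'b :: {banach, second_countable_topology}"
  shows integrable_lborel_shift: "integrable lborel f \<Longrightarrow> integrable lborel (\<lambda>x. f (x + a))"
    and integral_lborel_shift: "f \<in> borel_measurable borel \<Longrightarrow> (LINT x|lborel. f (x + a)) = (LINT x|lborel. f x)"
proof -
  have d: "lborel = distr lborel borel (\<lambda>x :: real ^ 'n. x + a)"
    unfolding add.commute[of _ a] by (rule lborel_distr_plus[symmetric])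
  show "integrable lborel (\<lambda>x. f (x + a))" if "integrable lborel f"
    by (rule integrable_distr[of "\<lambda>x. x + a" lborel borel]) (use that d in auto)
  show "(LINT x|lborel. f (x + a)) = (LINT x|lborel. f x)" if "f \<in> borel_measurable borel"
    by (subst (2) d, subst integral_distr) (use that in auto)
qed

text \<open>
  Integrating over space is integrating over a period after summing over the lattice. For a function
  with bounded support finitely many translates suffice, and the sum commutes with the integral.
\<close>
lemma integral_unfold_lattice:
  fixes f :: "real ^ 'n \<Rightarrow> 'b :: {banach, second_countable_topology}"
  assumes f: "integrable lborel f" and K: "finite K" "K \<subseteq> int_lattice"
    and supp: "\<forall>x. f x \<noteq> 0 \<longrightarrow> (\<exists>k\<in>K. x - k \<in> unit_cell)"
  shows "integrable lborel (\<lambda>y. indicator unit_cell y *\<^sub>R (\<Sum>k\<in>K. f (y + k)))"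
    and "(LINT y|lborel. indicator unit_cell y *\<^sub>R (\<Sum>k\<in>K. f (y + k))) = (LINT x|lborel. f x)"
proof -
  let ?g = "\<lambda>k x. indicator unit_cell (x - k) *\<^sub>R f x"
  have [measurable]: "f \<in> borel_measurable borel" using f by simp
  have g: "integrable lborel (?g k)" for k
    by (rule Bochner_Integration.integrable_bound[OF f]) (auto simp: indicator_def)
  have gs: "integrable lborel (\<lambda>y. indicator unit_cell y *\<^sub>R f (y + k))"
    "(LINT y|lborel. indicator unit_cell y *\<^sub>R f (y + k)) = (LINT x|lborel. ?g k x)" for k
    using integrable_lborel_shift[OF g, of k k] integral_lborel_shift[of "?g k" k] by simp_all
  have f_eq: "f x = (\<Sum>k\<in>K. ?g k x)" for x
  proof (cases "\<exists>k\<in>K. x - k \<in> unit_cell")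
    case True
    then obtain k where k: "k \<in> K" "x - k \<in> unit_cell" by blast
    have "x - l \<notin> unit_cell" if "l \<in> K" "l \<noteq> k" for l
    proof
      assume "x - l \<in> unit_cell"
      then have "(x - k) + (k - l) \<in> unit_cell" by simp
      then have "k - l = 0"
        using unit_cell_representative_unique[OF k(2)] that k K(2) diff_in_int_lattice by blast
      then show False using that by simp
    qed
    then have "(\<Sum>l\<in>K. ?g l x) = (\<Sum>l\<in>K. if l = k then f x else 0)"
      using k by (intro sum.cong) (auto simp: indicator_def)
    then show ?thesis using k K by (simp add: sum.delta)
  next
    case False
    then show ?thesis using supp by (auto simp: indicator_def intro!: sum.neutral[symmetric])
  qed
  show "integrable lborel (\<lambda>y. indicator unit_cell y *\<^sub>R (\<Sum>k\<in>K. f (y + k)))"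
    unfolding scaleR_sum_right using gs(1) by auto
  have "(LINT x|lborel. f x) = (\<Sum>k\<in>K. LINT x|lborel. ?g k x)"
    by (subst f_eq, rule Bochner_Integration.integral_sum) (use g in auto)
  also have "\<dots> = (LINT y|lborel. indicator unit_cell y *\<^sub>R (\<Sum>k\<in>K. f (y + k)))"
    unfolding scaleR_sum_right
    by (subst Bochner_Integration.integral_sum) (use gs in auto)
  finally show "(LINT y|lborel. indicator unit_cell y *\<^sub>R (\<Sum>k\<in>K. f (y + k))) = (LINT x|lborel. f x)" ..
qed

text \<open>
  Supplies the finite set of lattice vectors that \<open>integral_unfold_lattice\<close> asks for.
\<close>
lemma lattice_cover_of_bounded:
  fixes R :: real
  obtains K :: "(real ^ 'n) set" where "finite K" "K \<subseteq> int_lattice"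
    "\<And>x k. norm x \<le> R \<Longrightarrow> k \<in> int_lattice \<Longrightarrow> x - k \<in> unit_cell \<Longrightarrow> k \<in> K"
proof
  let ?K = "{k \<in> int_lattice. norm (k :: real ^ 'n) \<le> R + CARD('n)}"
  show "finite ?K" "?K \<subseteq> int_lattice" using finite_int_lattice_cball by auto
  fix x k :: "real ^ 'n" assume *: "norm x \<le> R" "k \<in> int_lattice" "x - k \<in> unit_cell"
  have "norm k \<le> norm x + norm (x - k)" by (metis norm_triangle_sub norm_minus_commute)
  then show "k \<in> ?K" using * norm_le_card_of_unit_cell[OF *(3)] by simp
qed

section \<open>Uniqueness of Fourier coefficients on the torus\<close>

text \<open>
  The kernel of the Fourier transform in the normalisation for which lattice frequencies are periodic
  with respect to \<open>int_lattice\<close>.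
\<close>
definition wave :: "real ^ 'n \<Rightarrow> real ^ 'n \<Rightarrow> complex" where
  "wave k x = cis (2 * pi * - (k \<bullet> x))"

lemma norm_wave [simp]: "norm (wave k x) = 1"
  by (simp add: wave_def)

lemma wave_measurable [measurable]: "wave k \<in> borel_measurable borel"
  unfolding wave_def cis_conv_exp by measurable

lemma wave_add_left: "wave (k + l) x = wave k x * wave l x"
  by (simp add: wave_def cis_mult inner_add_left algebra_simps)

lemma wave_add_right: "wave k (x + y) = wave k x * wave k y"
  by (simp add: wave_def cis_mult inner_add_right algebra_simps)

lemma wave_zero [simp]: "wave 0 x = 1"
  by (simp add: wave_def)

lemma wave_lattice_eq_1: "k \<in> int_lattice \<Longrightarrow> l \<in> int_lattice \<Longrightarrow> wave k l = 1"
  unfolding wave_def by (intro cis_multiple_2pi Ints_minus) (auto simp: inner_vec_def int_lattice_def)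

lemma wave_lattice_periodic:
  "k \<in> int_lattice \<Longrightarrow> l \<in> int_lattice \<Longrightarrow> wave k (x + l) = wave k x"
  by (simp add: wave_add_right wave_lattice_eq_1)

lemma integrable_wave_mult:
  "integrable lborel h \<Longrightarrow> integrable lborel (\<lambda>x. wave k x * h x)"
  by (rule Bochner_Integration.integrable_bound[of _ h]) (auto simp: norm_mult)

text \<open>
  Closure properties instead of a normal form with coefficients: multiplication is then an induction
  without any reindexing of sums.
\<close>
inductive trig_poly :: "(real ^ 'n \<Rightarrow> complex) \<Rightarrow> bool" where
  wave: "k \<in> int_lattice \<Longrightarrow> trig_poly (wave k)"
| add: "trig_poly f \<Longrightarrow> trig_poly g \<Longrightarrow> trig_poly (\<lambda>x. f x + g x)"
| scale: "trig_poly f \<Longrightarrow> trig_poly (\<lambda>x. c * f x)"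

lemma trig_poly_const: "trig_poly (\<lambda>x. c)"
  using trig_poly.scale[OF trig_poly.wave[OF zero_in_int_lattice], of c] by simp

lemma trig_poly_sum:
  "finite A \<Longrightarrow> (\<And>a. a \<in> A \<Longrightarrow> trig_poly (f a)) \<Longrightarrow> trig_poly (\<lambda>x. \<Sum>a\<in>A. f a x)"
  by (induction A rule: finite_induct) (auto intro: trig_poly_const trig_poly.add)

lemma trig_poly_mult:
  assumes "trig_poly f" "trig_poly g" shows "trig_poly (\<lambda>x. f x * g x)"
  using assms
proof (induction f rule: trig_poly.induct)
  case (wave k)
  from wave(2,1) show ?case
  proof (induction g rule: trig_poly.induct)
    case (wave l)
    then show ?case
      using trig_poly.wave[OF add_in_int_lattice[OF wave(2,1)]] by (simp add: wave_add_left[abs_def])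
  next
    case (add f g)
    then show ?case using trig_poly.add by (auto simp: distrib_left)
  next
    case (scale f c)
    then show ?case using trig_poly.scale[of _ c] by (auto simp: mult.left_commute)
  qed
next
  case (add f1 f2)
  then show ?case using trig_poly.add by (auto simp: distrib_right)
next
  case (scale f c)
  then show ?case using trig_poly.scale[of _ c] by (auto simp: mult.assoc)
qed

text \<open>
  Realises the torus as a compact subset of a Euclidean space, which makes the Stone--Weierstrass
  theorem for polynomial functions applicable to periodic functions.
\<close>
definition torus_embedding :: "real ^ 'n \<Rightarrow> complex ^ 'n" where
  "torus_embedding x = (\<chi> i. cis (2 * pi * x $ i))"

lemma continuous_torus_embedding: "continuous_on A torus_embedding"
  unfolding torus_embedding_def cis_conv_exp by (intro continuous_intros)

lemma torus_embedding_inj_on_unit_cell: "inj_on torus_embedding unit_cell"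
proof
  fix x y :: "real ^ 'n"
  assume x: "x \<in> unit_cell" and y: "y \<in> unit_cell" and eq: "torus_embedding x = torus_embedding y"
  have "(y - x) $ i \<in> \<int>" for i
  proof -
    have "cis (2 * pi * x $ i) = cis (2 * pi * y $ i)"
      using eq by (simp add: torus_embedding_def vec_eq_iff)
    then have "cis (2 * pi * x $ i) / cis (2 * pi * y $ i) = 1" by simp
    then have "cis (2 * pi * (x $ i - y $ i)) = 1" by (simp add: cis_divide right_diff_distrib)
    then have "cos (2 * pi * (x $ i - y $ i)) = 1" by (metis cis.sel(1) one_complex.sel(1))
    then obtain m where "2 * pi * (x $ i - y $ i) = of_int m * 2 * pi"
      using cos_one_2pi_int by blast
    then have "x $ i - y $ i = of_int m" by simp
    then have "(y - x) $ i = of_int (- m)" by simp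
    then show ?thesis by (metis Ints_of_int)
  qed
  then have "y - x = 0"
    using unit_cell_representative_unique[OF x, of "y - x"] y by (simp add: int_lattice_def)
  then show "x = y" by simp
qed

lemma vec_complex_expansion:
  fixes z :: "complex ^ 'n"
  shows "z = (\<Sum>i\<in>UNIV. Re (z $ i) *\<^sub>R axis i 1 + Im (z $ i) *\<^sub>R axis i \<i>)"
proof -
  have "(\<Sum>i\<in>UNIV. Re (z $ i) *\<^sub>R axis i 1 + Im (z $ i) *\<^sub>R axis i \<i>) $ j
      = (\<Sum>i\<in>UNIV. if i = j then z $ j else 0)" for j
    unfolding sum_component
    by (intro sum.cong) (auto simp: axis_def complex_eq_iff)
  then show ?thesis by (simp add: vec_eq_iff)
qed

text \<open>
  Polynomials in the real and imaginary parts of the coordinates pull back to polynomials in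
  \<open>cos (2\<pi>x\<^sub>i)\<close> and \<open>sin (2\<pi>x\<^sub>i)\<close>.
\<close>
lemma trig_poly_polynomial_torus:
  fixes p :: "complex ^ 'n \<Rightarrow> real"
  assumes "real_polynomial_function p"
  shows "trig_poly (\<lambda>x. complex_of_real (p (torus_embedding x)))"
  using assms
proof (induction p rule: real_polynomial_function.induct)
  case (linear f)
  interpret bounded_linear f by fact
  have axis: "axis i 1 \<in> (int_lattice :: (real ^ 'n) set)" for i
    by (simp add: int_lattice_def axis_def)
  have f: "f (torus_embedding x)
      = (\<Sum>i\<in>UNIV. cos (2 * pi * x $ i) * f (axis i 1) + sin (2 * pi * x $ i) * f (axis i \<i>))"
    for x :: "real ^ 'n"
    by (subst vec_complex_expansion) (simp add: sum add scale torus_embedding_def)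
  have cos: "complex_of_real (cos (2 * pi * x $ i)) = 1/2 * (wave (axis i 1) x + wave (- axis i 1) x)"
    and sin: "complex_of_real (sin (2 * pi * x $ i))
      = 1/(2*\<i>) * (wave (- axis i 1) x + (-1) * wave (axis i 1) x)"
    for x :: "real ^ 'n" and i
    by (simp_all add: wave_def inner_axis' complex_eq_iff)
  show ?case
    unfolding f of_real_sum of_real_add of_real_mult cos sin
    using axis uminus_in_int_lattice[OF axis]
    by (intro trig_poly_sum trig_poly.add trig_poly.scale trig_poly_mult trig_poly_const
        trig_poly.wave) auto
next
  case (const c)
  show ?case by (rule trig_poly_const)
next
  case (add f g)
  then show ?case by (simp add: trig_poly.add)
next
  case (mult f g)
  then show ?case by (simp add: trig_poly_mult)
qed

lemma integral_trig_poly_eq_0: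
  assumes "trig_poly t" and h: "integrable lborel h"
    and coeff: "\<And>k. k \<in> int_lattice \<Longrightarrow> (LINT x|lborel. wave k x * h x) = 0"
  shows "integrable lborel (\<lambda>x. t x * h x) \<and> (LINT x|lborel. t x * h x) = 0"
  using assms(1)
proof (induction t rule: trig_poly.induct)
  case (wave k)
  then show ?case using integrable_wave_mult[OF h] coeff by blast
next
  case (add f g)
  then show ?case by (simp add: distrib_right)
next
  case (scale f c)
  then show ?case by (simp add: mult.assoc)
qed

text \<open>
  Trigonometric polynomials approximate a continuous function uniformly, and the error in the integral
  is at most the uniform error times the \<open>L\<^sup>1\<close> norm of \<open>h\<close>.
\<close>
lemma integral_continuous_torus_eq_0:
  fixes g :: "complex ^ 'n \<Rightarrow> real"
  assumes g: "continuous_on UNIV g" and h: "integrable lborel h"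
    and coeff: "\<And>k. k \<in> int_lattice \<Longrightarrow> (LINT x|lborel. wave k x * h x) = 0"
  shows "(LINT x|lborel. complex_of_real (g (torus_embedding x)) * h x) = 0"
proof -
  let ?S = "cball 0 (real CARD('n)) :: (complex ^ 'n) set"
  let ?I = "LINT x|lborel. complex_of_real (g (torus_embedding x)) * h x"
  have S: "torus_embedding x \<in> ?S" for x :: "real ^ 'n"
    by (simp add: norm_vec_def L2_set_def torus_embedding_def real_sqrt_le_iff' power2_eq_square)
  have [measurable]: "h \<in> borel_measurable borel" using h by simp
  have [measurable]: "torus_embedding \<in> borel_measurable (borel :: (real ^ 'n) measure)"
    using continuous_torus_embedding by (rule borel_measurable_continuous_onI)
  have [measurable]: "g \<in> borel_measurable borel"
    using g by (rule borel_measurable_continuous_onI)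
  have bound: "norm ?I \<le> e * (LINT x|lborel. norm (h x))" if e: "e > 0" for e
  proof -
    obtain p where p: "real_polynomial_function p" "\<And>x. x \<in> ?S \<Longrightarrow> \<bar>g x - p x\<bar> < e"
      using Stone_Weierstrass_real_polynomial_function[of ?S g e] g e
      by (metis compact_cball continuous_on_subset subset_UNIV)
    let ?p = "\<lambda>x. complex_of_real (p (torus_embedding x)) * h x"
    let ?d = "\<lambda>x. complex_of_real (g (torus_embedding x) - p (torus_embedding x)) * h x"
    have [measurable]: "p \<in> borel_measurable borel"
      using p(1) continuous_real_polymonial_function
      by (intro borel_measurable_continuous_onI) (auto simp: continuous_on_eq_continuous_within)
    have P: "integrable lborel ?p" "integral\<^sup>L lborel ?p = 0"
      using integral_trig_poly_eq_0[OF trig_poly_polynomial_torus[OF p(1)] h coeff] by auto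
    have eh: "integrable lborel (\<lambda>x. e * norm (h x))" using h by simp
    have le: "norm (?d x) \<le> e * norm (h x)" for x
      using p(2)[OF S[of x]] by (simp add: norm_mult mult_right_mono less_imp_le flip: of_real_diff)
    have d: "integrable lborel ?d"
    proof (rule Bochner_Integration.integrable_bound[OF eh])
      show "AE x in lborel. norm (?d x) \<le> norm (e * norm (h x))"
        using order_trans[OF le abs_ge_self] by (intro AE_I2) (simp only: real_norm_def)
    qed measurable
    have "?I = (LINT x|lborel. ?d x + ?p x)"
      by (intro Bochner_Integration.integral_cong) (auto simp: algebra_simps)
    also have "\<dots> = integral\<^sup>L lborel ?d" using d P by simp
    finally have "norm ?I = norm (integral\<^sup>L lborel ?d)" by simp
    also have "\<dots> \<le> (LINT x|lborel. norm (?d x))" by (rule integral_norm_bound)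
    also have "\<dots> \<le> (LINT x|lborel. e * norm (h x))"
      using d eh le by (intro integral_mono) auto
    finally show ?thesis by simp
  qed
  define C where "C = (LINT x|lborel. norm (h x))"
  have C: "0 \<le> C" unfolding C_def by (rule integral_nonneg_AE) auto
  have "norm ?I \<le> 0 + d" if "d > 0" for d
  proof -
    have "norm ?I \<le> d / (C + 1) * C" using bound[of "d / (C + 1)"] C that
      by (simp flip: C_def)
    also have "\<dots> \<le> d" using C that by (simp add: field_simps)
    finally show ?thesis by simp
  qed
  then have "norm ?I \<le> 0" by (rule field_le_epsilon)
  then show ?thesis by simp
qed

text \<open>
  The indicator of the compact image of \<open>C\<close> on the torus is a pointwise limit of continuous functions
  with values in \<open>[0, 1]\<close>. Since the torus embedding is injective on the unit cell, this indicator
  pulls back, on the support of \<open>h\<close>, to the indicator of \<open>C\<close>.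
\<close>
lemma integral_compact_eq_0_of_fourier_coeff:
  fixes h :: "real ^ 'n \<Rightarrow> complex"
  assumes h: "integrable lborel h" and supp: "\<And>x. x \<notin> unit_cell \<Longrightarrow> h x = 0"
    and coeff: "\<And>k. k \<in> int_lattice \<Longrightarrow> (LINT x|lborel. wave k x * h x) = 0"
    and C: "compact C" "C \<subseteq> unit_cell"
  shows "(LINT x|lborel. indicator C x *\<^sub>R h x) = 0"
proof (cases "C = {}")
  case False
  let ?D = "torus_embedding ` C"
  let ?g = "\<lambda>(m::nat) z. max 0 (1 - real m * infdist z ?D)"
  have [measurable]: "h \<in> borel_measurable borel" using h by simp
  have [measurable]: "torus_embedding \<in> borel_measurable (borel :: (real ^ 'n) measure)"
    using continuous_torus_embedding by (rule borel_measurable_continuous_onI)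
  have g: "continuous_on UNIV (?g m)" for m
    by (intro continuous_intros continuous_on_infdist)
  have [measurable]: "?g m \<in> borel_measurable borel" for m
    using g by (rule borel_measurable_continuous_onI)
  have [measurable]: "C \<in> sets borel" by (rule borel_closed[OF compact_imp_closed[OF C(1)]])
  have D: "closed ?D" "?D \<noteq> {}"
    using C(1) False compact_continuous_image[OF continuous_torus_embedding] compact_imp_closed by auto
  have lim: "(\<lambda>m. ?g m z) \<longlonglongrightarrow> indicator ?D z" for z
  proof (cases "z \<in> ?D")
    case True
    then show ?thesis by simp
  next
    case z: False
    then have pos: "infdist z ?D > 0" using D by (simp add: infdist_pos_not_in_closed)
    then obtain M :: nat where M: "M * infdist z ?D > 1"
      using reals_Archimedean3 by blast
    have "?g m z = 0" if "m \<ge> M" for m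
    proof -
      have "real M * infdist z ?D \<le> real m * infdist z ?D"
        using that pos by (intro mult_right_mono) auto
      then show ?thesis using M by simp
    qed
    then have "\<forall>\<^sub>F m in sequentially. ?g m z = 0" using eventually_sequentially by blast
    then show ?thesis using z by (simp add: tendsto_eventually)
  qed
  have eq: "indicator ?D (torus_embedding x) *\<^sub>R h x = indicator C x *\<^sub>R h x" for x
  proof (cases "x \<in> unit_cell")
    case True
    then have "torus_embedding x \<in> ?D \<longleftrightarrow> x \<in> C"
      using inj_on_image_mem_iff[OF torus_embedding_inj_on_unit_cell True C(2)] by simp
    then show ?thesis by (simp add: indicator_def)
  qed (use supp in simp)
  have "(\<lambda>m. LINT x|lborel. ?g m (torus_embedding x) *\<^sub>R h x)
      \<longlonglongrightarrow> (LINT x|lborel. indicator C x *\<^sub>R h x)"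
  proof (rule integral_dominated_convergence[where w = "\<lambda>x. norm (h x)"])
    show "AE x in lborel. (\<lambda>m. ?g m (torus_embedding x) *\<^sub>R h x) \<longlonglongrightarrow> indicator C x *\<^sub>R h x"
      unfolding eq[symmetric] by (intro AE_I2 tendsto_scaleR lim tendsto_const)
    show "AE x in lborel. norm (?g m (torus_embedding x) *\<^sub>R h x) \<le> norm (h x)" for m
      by (auto intro!: mult_left_le_one_le simp: infdist_nonneg)
  qed (use h in auto)
  moreover have "(LINT x|lborel. ?g m (torus_embedding x) *\<^sub>R h x) = 0" for m
    using integral_continuous_torus_eq_0[OF g h coeff] by (simp add: scaleR_conv_of_real)
  ultimately have "(\<lambda>m::nat. 0) \<longlonglongrightarrow> (LINT x|lborel. indicator C x *\<^sub>R h x)"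
    by (simp only:)
  then show ?thesis by (simp add: LIMSEQ_const_iff)
qed simp

text \<open>
  By inner regularity the set where \<open>f\<close> is positive is exhausted up to small measure by compact sets,
  and a positive function with integral zero over a set forces that set to be null.
\<close>
lemma AE_nonpos_of_integral_compact_eq_0:
  fixes f :: "'a :: euclidean_space \<Rightarrow> real"
  assumes f: "integrable lborel f" and Q: "bounded Q" "\<And>x. x \<notin> Q \<Longrightarrow> f x = 0"
    and C: "\<And>C. compact C \<Longrightarrow> C \<subseteq> Q \<Longrightarrow> (LINT x|lborel. indicator C x *\<^sub>R f x) = 0"
  shows "AE x in lborel. f x \<le> 0"
proof -
  let ?A = "{x. f x > 0}"
  have [measurable]: "f \<in> borel_measurable borel" using f by simp
  have A: "?A \<in> sets borel" by measurable
  have le: "emeasure lebesgue ?A \<le> 0 + ennreal e" if e: "e > 0" for e :: real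
  proof -
    have "?A \<in> sets lebesgue" using A by simp
    then obtain T where T: "closed T" "T \<subseteq> ?A" "emeasure lebesgue (?A - T) < ennreal e"
      using e by (rule sets_lebesgue_inner_closed)
    have TQ: "T \<subseteq> Q" using T Q by force
    then have "compact T" using T Q(1) bounded_subset compact_eq_bounded_closed by blast
    then have I: "(LINT x|lborel. indicator T x *\<^sub>R f x) = 0" using C TQ by blast
    have [measurable]: "T \<in> sets borel" by (rule borel_closed[OF T(1)])
    have "integrable lborel (\<lambda>x. indicator T x *\<^sub>R f x)"
      by (rule Bochner_Integration.integrable_bound[OF f]) (auto simp: indicator_def)
    then have "AE x in lborel. indicator T x *\<^sub>R f x = 0"
      using I T(2)
      by (subst (asm) integral_nonneg_eq_0_iff_AE) (auto simp: indicator_def less_imp_le intro!: AE_I2)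
    then have "AE x in lborel. x \<notin> T"
      by eventually_elim (use T(2) in \<open>auto simp: indicator_def split: if_splits\<close>)
    then have "emeasure lborel T = 0" by (subst (asm) AE_iff_measurable) auto
    then have "emeasure lebesgue T = 0" by simp
    moreover have "emeasure lebesgue ?A \<le> emeasure lebesgue T + emeasure lebesgue (?A - T)"
      using emeasure_subadditive[of T lebesgue "?A - T"] T(2) A by (simp add: Un_absorb1)
    ultimately show ?thesis using T(3) by simp
  qed
  have "emeasure lebesgue ?A \<le> 0" by (rule ennreal_le_epsilon) (rule le)
  then have "?A \<in> null_sets lborel" using A by (simp add: null_sets_def)
  then have "AE x in lborel. x \<notin> ?A" by (rule AE_not_in)
  then show ?thesis by eventually_elim auto
qed

text \<open>
  Real and imaginary part are handled together: it is enough that \<open>Re (c h) \<le> 0\<close> for each fourth root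
  of unity \<open>c\<close>.
\<close>
lemma fourier_coeff_unique_unit_cell:
  fixes h :: "real ^ 'n \<Rightarrow> complex"
  assumes h: "integrable lborel h" and supp: "\<And>x. x \<notin> unit_cell \<Longrightarrow> h x = 0"
    and coeff: "\<And>k. k \<in> int_lattice \<Longrightarrow> (LINT x|lborel. wave k x * h x) = 0"
  shows "AE x in lborel. h x = 0"
proof -
  have bdd: "bounded (unit_cell :: (real ^ 'n) set)"
    using norm_le_card_of_unit_cell by (auto simp: bounded_iff)
  have nonpos: "AE x in lborel. Re (c * h x) \<le> 0" for c
  proof (rule AE_nonpos_of_integral_compact_eq_0[OF _ bdd])
    fix C :: "(real ^ 'n) set" assume C: "compact C" "C \<subseteq> unit_cell"
    have [measurable]: "C \<in> sets borel" by (rule borel_closed[OF compact_imp_closed[OF C(1)]])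
    have [measurable]: "h \<in> borel_measurable borel" using h by simp
    have i: "integrable lborel (\<lambda>x. indicator C x *\<^sub>R h x)"
      by (rule Bochner_Integration.integrable_bound[OF h]) (auto simp: indicator_def)
    have "(LINT x|lborel. indicator C x *\<^sub>R Re (c * h x))
        = (LINT x|lborel. Re (c * (indicator C x *\<^sub>R h x)))"
      by (intro Bochner_Integration.integral_cong) (auto simp: algebra_simps)
    also have "\<dots> = Re (LINT x|lborel. c * (indicator C x *\<^sub>R h x))"
      using i by (intro integral_Re integrable_mult_right)
    also have "\<dots> = Re (c * (LINT x|lborel. indicator C x *\<^sub>R h x))"
      by (subst integral_mult_right_zero) (rule refl)
    finally show "(LINT x|lborel. indicator C x *\<^sub>R Re (c * h x)) = 0"
      using integral_compact_eq_0_of_fourier_coeff[OF h supp coeff C] by simp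
  qed (use h supp in auto)
  show ?thesis
    using nonpos[of 1] nonpos[of "-1"] nonpos[of \<i>] nonpos[of "-\<i>"]
    by eventually_elim (auto simp: complex_eq_iff)
qed

section \<open>Biorthogonal families of waves\<close>

text \<open>
  Gaussian elimination: an equation with a nonzero coefficient at the unknown \<open>i\<close> is used to eliminate
  \<open>x\<^sub>i\<close> from the other equations.
\<close>
lemma underdetermined_system_nontrivial_solution:
  fixes A :: "'m \<Rightarrow> 'j \<Rightarrow> 'a :: field"
  assumes "finite M" "finite J" "card M < card J"
  shows "\<exists>x. (\<exists>j\<in>J. x j \<noteq> 0) \<and> (\<forall>m\<in>M. (\<Sum>j\<in>J. A m j * x j) = 0)"
  using assms
proof (induction M arbitrary: J A rule: finite_induct)
  case empty
  then have "J \<noteq> {}" by auto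
  then show ?case by (intro exI[of _ "\<lambda>_. 1"]) auto
next
  case (insert m M)
  show ?case
  proof (cases "\<forall>j\<in>J. A m j = 0")
    case True
    have "card M < card J" using insert by simp
    from insert.IH[OF insert.prems(1) this, of A] True show ?thesis by auto
  next
    case False
    then obtain i where i: "i \<in> J" "A m i \<noteq> 0" by blast
    let ?J = "J - {i}"
    let ?B = "\<lambda>k j. A k j - A k i * A m j / A m i"
    have "card M < card ?J" using insert i by simp
    then obtain x where x: "\<exists>j\<in>?J. x j \<noteq> 0" "\<And>k. k \<in> M \<Longrightarrow> (\<Sum>j\<in>?J. ?B k j * x j) = 0"
      using insert.IH[of ?J ?B] insert.prems(1) by auto
    define s where "s = (\<Sum>j\<in>?J. A m j * x j)"
    define y where "y = x(i := - s / A m i)"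
    \<comment> \<open>the unknown \<open>i\<close> contributes \<open>- A k i * s / A m i\<close>, which eliminates it from every equation\<close>
    have sum_y: "(\<Sum>j\<in>J. A k j * y j) = (\<Sum>j\<in>?J. A k j * x j) - A k i * s / A m i" for k
    proof -
      have "(\<Sum>j\<in>?J. A k j * y j) = (\<Sum>j\<in>?J. A k j * x j)"
        by (intro sum.cong) (auto simp: y_def)
      then show ?thesis
        using insert.prems(1) i by (subst sum.remove[of J i]) (auto simp: y_def)
    qed
    have "(\<Sum>j\<in>J. A k j * y j) = 0" if "k \<in> insert m M" for k
    proof (cases "k = m")
      case True
      then show ?thesis using i by (simp add: sum_y flip: s_def)
    next
      case False
      then have "0 = (\<Sum>j\<in>?J. ?B k j * x j)" using x(2) that by simp
      also have "\<dots> = (\<Sum>j\<in>?J. A k j * x j) - A k i * s / A m i"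
        by (simp add: s_def left_diff_distrib sum_subtractf sum_distrib_left sum_divide_distrib mult.assoc)
      finally show ?thesis by (simp add: sum_y)
    qed
    moreover have "\<exists>j\<in>J. y j \<noteq> 0" using x(1) by (auto simp: y_def)
    ultimately show ?thesis by blast
  qed
qed

text \<open>
  Otherwise the columns of \<open>G\<close> would satisfy a nontrivial linear relation, and applying \<open>A\<close> to it would
  show all its coefficients to vanish.
\<close>
lemma card_le_card_of_biorthogonal:
  fixes A :: "'j \<Rightarrow> 'm \<Rightarrow> 'a :: field" and G :: "'m \<Rightarrow> 'j \<Rightarrow> 'a"
  assumes fin: "finite J" "finite M"
    and AG: "\<And>i j. i \<in> J \<Longrightarrow> j \<in> J \<Longrightarrow> (\<Sum>m\<in>M. A i m * G m j) = (if i = j then 1 else 0)"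
  shows "card J \<le> card M"
proof (rule ccontr)
  assume "\<not> card J \<le> card M"
  then obtain x where x: "\<exists>j\<in>J. x j \<noteq> 0" "\<forall>m\<in>M. (\<Sum>j\<in>J. G m j * x j) = 0"
    using underdetermined_system_nontrivial_solution[OF fin(2,1), of G] by auto
  have "x i = 0" if i: "i \<in> J" for i
  proof -
    have "x i = (\<Sum>j\<in>J. (if i = j then 1 else 0) * x j)"
      using i fin by (simp add: if_distrib[of "\<lambda>t. t * _"] cong: if_cong)
    also have "\<dots> = (\<Sum>j\<in>J. (\<Sum>m\<in>M. A i m * G m j) * x j)"
      using AG i by (intro sum.cong) auto
    also have "\<dots> = (\<Sum>m\<in>M. A i m * (\<Sum>j\<in>J. G m j * x j))"
      by (simp add: sum_distrib_left sum_distrib_right mult.assoc sum.swap[of _ J])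
    also have "\<dots> = 0" using x(2) by simp
    finally show ?thesis .
  qed
  then show False using x(1) by blast
qed

lemma indicator_unit_cell_integrable:
  "integrable lborel (indicator unit_cell :: real ^ 'n \<Rightarrow> real)"
  by (rule integrable_real_indicator) (auto simp: emeasure_unit_cell)

text \<open>
  For \<open>k \<noteq> 0\<close> a translation by half a wavelength changes the sign of the wave, while it preserves the
  integral over a period; so the integral equals its negative.
\<close>
lemma integral_wave_unit_cell:
  fixes k :: "real ^ 'n"
  assumes k: "k \<in> int_lattice"
  shows "(LINT x|lborel. indicator unit_cell x *\<^sub>R wave k x) = (if k = 0 then 1 else 0)"
proof (cases "k = 0")
  case True
  have "(LINT x|lborel. indicator unit_cell x *\<^sub>R wave k x)
      = (LINT x|lborel. complex_of_real (indicator unit_cell (x :: real ^ 'n)))"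
    by (intro Bochner_Integration.integral_cong) (auto simp: True indicator_def)
  also have "\<dots> = 1" by (simp add: measure_def emeasure_unit_cell)
  finally show ?thesis using True by simp
next
  case False
  let ?I = "LINT x|lborel. indicator unit_cell x *\<^sub>R wave k x"
  \<comment> \<open>half a wavelength in the direction of \<open>k\<close>\<close>
  define a where "a = (1 / (2 * (k \<bullet> k))) *\<^sub>R k"
  have wave_a: "wave k a = -1"
    using False by (simp add: wave_def a_def complex_eq_iff)
  define f where "f = (\<lambda>x. indicator unit_cell (x - a) *\<^sub>R wave k x)"
  obtain K where K: "finite K" "K \<subseteq> (int_lattice :: (real ^ 'n) set)"
    "\<And>x k. norm x \<le> CARD('n) + norm a \<Longrightarrow> k \<in> int_lattice \<Longrightarrow> x - k \<in> unit_cell \<Longrightarrow> k \<in> K"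
    using lattice_cover_of_bounded by metis
  have norm_le: "norm x \<le> CARD('n) + norm a" if "x - a \<in> unit_cell" for x
    using norm_le_card_of_unit_cell[OF that] norm_triangle_sub[of x a] by linarith
  have "integrable lborel (\<lambda>x. indicator unit_cell (x + - a) :: real)"
    using indicator_unit_cell_integrable by (rule integrable_lborel_shift)
  then have f: "integrable lborel f" unfolding f_def
    by (rule Bochner_Integration.integrable_bound) (auto simp: indicator_def)
  have f_sum: "(\<Sum>l\<in>K. f (y + l)) = wave k y" if y: "y \<in> unit_cell" for y
  proof -
    obtain m where m: "m \<in> int_lattice" "y - a - m \<in> unit_cell"
      by (rule unit_cell_representative)
    have mK: "- m \<in> K"
      using K(3)[OF norm_le, of "y - m" "- m"] m uminus_in_int_lattice[OF m(1)] y
      by (simp add: algebra_simps)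
    have "f (y + l) = (if l = - m then wave k y else 0)" if l: "l \<in> K" for l
    proof -
      have "y + l - a \<in> unit_cell \<longleftrightarrow> l = - m"
      proof
        assume "y + l - a \<in> unit_cell"
        then have "(y - a - m) + (l + m) \<in> unit_cell" by (simp add: algebra_simps)
        then have "l + m = 0"
          using unit_cell_representative_unique[OF m(2)] l K(2) add_in_int_lattice m(1) by blast
        then show "l = - m" by (simp add: eq_neg_iff_add_eq_0)
      qed (use m(2) in \<open>simp add: algebra_simps\<close>)
      then show ?thesis
        using wave_lattice_periodic[OF k, of l y] l K(2) by (auto simp: f_def indicator_def)
    qed
    then have "(\<Sum>l\<in>K. f (y + l)) = (\<Sum>l\<in>K. if l = - m then wave k y else 0)"
      by (intro sum.cong) auto
    then show ?thesis using mK K(1) by simp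
  qed
  have "?I = (LINT y|lborel. indicator unit_cell y *\<^sub>R (\<Sum>l\<in>K. f (y + l)))"
    by (intro Bochner_Integration.integral_cong) (auto simp: f_sum indicator_def)
  also have "\<dots> = (LINT x|lborel. f x)"
  proof (rule integral_unfold_lattice(2)[OF f K(1,2)], intro allI impI)
    fix x assume "f x \<noteq> 0"
    then have x: "norm x \<le> CARD('n) + norm a"
      by (intro norm_le) (auto simp: f_def indicator_def split: if_splits)
    obtain l where "l \<in> int_lattice" "x - l \<in> unit_cell" by (rule unit_cell_representative)
    then show "\<exists>l\<in>K. x - l \<in> unit_cell" using K(3)[OF x] by blast
  qed
  also have "\<dots> = (LINT x|lborel. f (x + a))"
    using f by (intro integral_lborel_shift[symmetric]) auto
  also have "\<dots> = (LINT x|lborel. - (indicator unit_cell x *\<^sub>R wave k x))"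
    by (intro Bochner_Integration.integral_cong) (auto simp: f_def wave_add_right wave_a)
  also have "\<dots> = - ?I" by simp
  finally show ?thesis using False by simp
qed

text \<open>
  The density bound. The hypothesis prescribes all Fourier coefficients of the periodic functions
  \<open>H v u\<close> below and so determines them almost everywhere; at almost every point \<open>y\<close> of the unit cell
  this is a biorthogonality relation indexed by the lattice points \<open>k\<close> with \<open>y + k \<in> S\<close>. The number of
  these \<open>k\<close> integrates to the measure of \<open>S\<close>.
\<close>
lemma card_le_measure_of_biorthogonal_waves:
  fixes U :: "(real ^ 'n) set" and G :: "real ^ 'n \<Rightarrow> real ^ 'n \<Rightarrow> complex"
  assumes U: "finite U" and S: "S \<in> sets borel" "\<And>x. x \<in> S \<Longrightarrow> norm x \<le> R"
    and G: "\<And>u. u \<in> U \<Longrightarrow> integrable lborel (G u)"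
    and supp: "\<And>u x. x \<notin> S \<Longrightarrow> G u x = 0"
    and biorth: "\<And>u v k. u \<in> U \<Longrightarrow> v \<in> U \<Longrightarrow> k \<in> int_lattice \<Longrightarrow>
      (LINT x|lborel. wave (v + k) x * G u x) = (if v = u \<and> k = 0 then 1 else 0)"
  shows "card U \<le> measure lborel S"
proof -
  obtain K where K: "finite K" "K \<subseteq> (int_lattice :: (real ^ 'n) set)"
    "\<And>x k. norm x \<le> R \<Longrightarrow> k \<in> int_lattice \<Longrightarrow> x - k \<in> unit_cell \<Longrightarrow> k \<in> K"
    using lattice_cover_of_bounded by metis
  have cover: "\<exists>k\<in>K. x - k \<in> unit_cell" if "x \<in> S" for x
    using K(3)[OF S(2)[OF that]] unit_cell_representative by metis
  define H where "H = (\<lambda>v u y. \<Sum>k\<in>K. wave v (y + k) * G u (y + k))"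
  have fiber: "AE y in lborel. y \<in> unit_cell \<longrightarrow> H v u y = (if v = u then 1 else 0)"
    if uv: "u \<in> U" "v \<in> U" for u v
  proof -
    let ?\<delta> = "if v = u then 1 else 0 :: complex"
    let ?h = "\<lambda>y. indicator unit_cell y *\<^sub>R (H v u y - ?\<delta>)"
    have unfold: "integrable lborel (\<lambda>y. indicator unit_cell y *\<^sub>R (wave l y * H v u y))"
      "(LINT y|lborel. indicator unit_cell y *\<^sub>R (wave l y * H v u y)) = (if v = u \<and> l = 0 then 1 else 0)"
      if l: "l \<in> int_lattice" for l
    proof -
      let ?f = "\<lambda>x. wave (v + l) x * G u x"
      have f: "integrable lborel ?f" using G[OF uv(1)] by (rule integrable_wave_mult)
      have *: "wave l y * H v u y = (\<Sum>k\<in>K. ?f (y + k))" for y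
        unfolding H_def sum_distrib_left
      proof (rule sum.cong)
        fix k assume "k \<in> K"
        then show "wave l y * (wave v (y + k) * G u (y + k)) = ?f (y + k)"
          using wave_lattice_periodic[OF l, of k y] K(2) by (auto simp: wave_add_left)
      qed simp
      have "\<forall>x. ?f x \<noteq> 0 \<longrightarrow> (\<exists>k\<in>K. x - k \<in> unit_cell)"
        using cover supp by (metis mult_zero_right)
      note unf = integral_unfold_lattice[OF f K(1,2) this]
      show "integrable lborel (\<lambda>y. indicator unit_cell y *\<^sub>R (wave l y * H v u y))"
        unfolding * by (rule unf(1))
      show "(LINT y|lborel. indicator unit_cell y *\<^sub>R (wave l y * H v u y)) = (if v = u \<and> l = 0 then 1 else 0)"
        unfolding * using unf(2) biorth[OF uv l] by (rule trans)
    qed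
    have cell: "integrable lborel (\<lambda>y. indicator unit_cell y *\<^sub>R wave l y)" for l :: "real ^ 'n"
      by (rule Bochner_Integration.integrable_bound[OF indicator_unit_cell_integrable])
        (auto simp: indicator_def)
    \<comment> \<open>the constant \<open>?\<delta>\<close> has the same Fourier coefficients as \<open>H v u\<close>\<close>
    have split: "wave l y * ?h y = indicator unit_cell y *\<^sub>R (wave l y * H v u y)
        - ?\<delta> * (indicator unit_cell y *\<^sub>R wave l y)" for l y
      by (simp add: algebra_simps)
    have "AE y in lborel. ?h y = 0"
    proof (rule fourier_coeff_unique_unit_cell)
      show "integrable lborel ?h"
        using Bochner_Integration.integrable_diff[OF unfold(1) integrable_mult_right[OF cell, of ?\<delta>], of 0 0]
          split[of 0] by (simp add: zero_in_int_lattice)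
      fix l :: "real ^ 'n" assume l: "l \<in> int_lattice"
      have "(LINT y|lborel. wave l y * ?h y) =
          (LINT y|lborel. indicator unit_cell y *\<^sub>R (wave l y * H v u y))
          - (LINT y|lborel. ?\<delta> * (indicator unit_cell y *\<^sub>R wave l y))"
        unfolding split
        by (rule Bochner_Integration.integral_diff[OF unfold(1)[OF l] integrable_mult_right[OF cell]])
      also have "\<dots> = 0"
        unfolding unfold(2)[OF l] integral_mult_right_zero integral_wave_unit_cell[OF l] by simp
      finally show "(LINT y|lborel. wave l y * ?h y) = 0" .
    qed simp
    then show ?thesis by eventually_elim (auto simp: indicator_def split: if_splits)
  qed
  have "AE y in lborel. \<forall>v\<in>U. \<forall>u\<in>U. y \<in> unit_cell \<longrightarrow> H v u y = (if v = u then 1 else 0)"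
    unfolding AE_finite_all[OF U] using fiber by blast
  then have count: "AE y in lborel. indicator unit_cell y *\<^sub>R real (card U)
      \<le> indicator unit_cell y *\<^sub>R (\<Sum>k\<in>K. indicator S (y + k))"
  proof eventually_elim
    case (elim y)
    show ?case
    proof (cases "y \<in> unit_cell")
      case True
      let ?M = "{k \<in> K. y + k \<in> S}"
      have "card U \<le> card ?M"
      proof (rule card_le_card_of_biorthogonal[where A = "\<lambda>v k. wave v (y + k)" and G = "\<lambda>k u. G u (y + k)"])
        fix v u assume "v \<in> U" "u \<in> U"
        have "(\<Sum>k\<in>?M. wave v (y + k) * G u (y + k)) = H v u y"
          unfolding H_def using K(1) supp by (intro sum.mono_neutral_left) auto
        then show "(\<Sum>k\<in>?M. wave v (y + k) * G u (y + k)) = (if v = u then 1 else 0)"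
          using elim True \<open>v \<in> U\<close> \<open>u \<in> U\<close> by simp
      qed (use U K(1) in auto)
      also have "real (card ?M) = (\<Sum>k\<in>K. indicator S (y + k))"
        using K(1) by (simp add: indicator_def sum.If_cases Int_def)
      finally show ?thesis using True by simp
    qed simp
  qed
  have "bounded S" using S(2) by (auto simp: bounded_iff)
  then have fin: "emeasure lborel S < \<infinity>" by (rule emeasure_bounded_finite)
  then have i: "integrable lborel (indicator S :: real ^ 'n \<Rightarrow> real)"
    using S(1) by (intro integrable_real_indicator) auto
  have "\<forall>x. indicat_real S x \<noteq> 0 \<longrightarrow> (\<exists>k\<in>K. x - k \<in> unit_cell)"
    using cover by (metis indicator_simps(2))
  note unf = integral_unfold_lattice[OF i K(1,2) this]
  have "real (card U) = (LINT y|lborel. indicat_real (unit_cell :: (real ^ 'n) set) y *\<^sub>R real (card U))"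
    by (simp add: measure_def emeasure_unit_cell)
  also have "\<dots> \<le> (LINT y|lborel. indicat_real unit_cell y *\<^sub>R (\<Sum>k\<in>K. indicat_real S (y + k)))"
    using indicator_unit_cell_integrable unf(1) count by (intro integral_mono_AE) auto
  also have "\<dots> = measure lborel S" unfolding unf(2) by simp
  finally show ?thesis .
qed

section \<open>A dense periodic packing\<close>

text \<open>
  The points of \<open>U + \<int>\<^sup>n\<close> are pairwise more than \<open>1/4\<close> apart. With the period scaled to \<open>1\<close>, any separation
  below \<open>1/2\<close> leaves room in the cell for the two points with overlapping balls.
\<close>
definition periodic_packing :: "(real ^ 'n) set \<Rightarrow> bool" where
  "periodic_packing U \<longleftrightarrow> U \<subseteq> unit_cell \<and>
     (\<forall>u\<in>U. \<forall>v\<in>U. \<forall>k\<in>int_lattice. u - v + k \<noteq> 0 \<longrightarrow> 1 / 4 < norm (u - v + k))"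

text \<open>
  Makes maximal packings available: the unit cell is covered by finitely many balls of radius \<open>1/8\<close>,
  and each of these contains at most one point of a packing.
\<close>
lemma periodic_packing_card_bounded:
  obtains N where "\<And>U :: (real ^ 'n) set. periodic_packing U \<Longrightarrow> finite U \<and> card U \<le> N"
proof -
  have "compact (cball 0 CARD('n) :: (real ^ 'n) set)" by (rule compact_cball)
  then have "\<exists>T. finite T \<and> cball 0 CARD('n) \<subseteq> (\<Union>x\<in>T. ball (x :: real ^ 'n) (1 / 8))"
    unfolding compact_eq_totally_bounded by (auto dest: spec[of _ "1/8 :: real"])
  then obtain T where T: "finite T" "cball 0 CARD('n) \<subseteq> (\<Union>x\<in>T. ball (x :: real ^ 'n) (1 / 8))"
    by blast
  have "finite U \<and> card U \<le> card T" if U: "periodic_packing U" for U :: "(real ^ 'n) set"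
  proof -
    have "\<exists>t\<in>T. u \<in> ball t (1 / 8)" if "u \<in> U" for u
      using T(2) that U norm_le_card_of_unit_cell[of u] by (force simp: periodic_packing_def)
    then obtain f where f: "\<And>u. u \<in> U \<Longrightarrow> f u \<in> T \<and> u \<in> ball (f u) (1 / 8)" by metis
    have "inj_on f U"
    proof (rule inj_onI, rule ccontr)
      fix u v assume *: "u \<in> U" "v \<in> U" "f u = f v" "u \<noteq> v"
      have "dist u v < 1 / 8 + 1 / 8"
        using f[OF *(1)] f[OF *(2)] *(3) by (intro dist_triangle_less_add[of _ "f u"]) (auto simp: dist_commute)
      moreover have "1 / 4 < norm (u - v + 0)"
        using U *(1,2,4) zero_in_int_lattice unfolding periodic_packing_def
        by (metis add.right_neutral right_minus_eq)
      ultimately show False by (simp add: dist_norm)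
    qed
    moreover have "f ` U \<subseteq> T" using f by blast
    ultimately show ?thesis using T(1) by (meson card_inj_on_le inj_on_finite)
  qed
  then show ?thesis using that by blast
qed

text \<open>
  A point farther than \<open>1/4\<close> from all of \<open>U + \<int>\<^sup>n\<close> could be added to \<open>U\<close>.
\<close>
lemma maximal_periodic_packing_covers:
  assumes U: "periodic_packing U" and y: "y \<in> unit_cell"
    and no_ext: "\<And>y. y \<notin> U \<Longrightarrow> \<not> periodic_packing (insert y U)"
  shows "\<exists>u\<in>U. \<exists>k\<in>int_lattice. norm (y + k - u) \<le> 1 / 4"
proof (rule ccontr)
  assume "\<not> ?thesis"
  then have far: "1 / 4 < norm (y + k - u)" if "u \<in> U" "k \<in> int_lattice" for u k
    using that by force
  have "y \<notin> U" using far[of y 0] zero_in_int_lattice by auto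
  moreover have "periodic_packing (insert y U)"
    unfolding periodic_packing_def
  proof (intro conjI ballI impI)
    show "insert y U \<subseteq> unit_cell" using U y by (simp add: periodic_packing_def)
    fix u v k assume *: "u \<in> insert y U" "v \<in> insert y U" "k \<in> int_lattice" "u - v + k \<noteq> 0"
    consider "u = v" | "u = y" "v \<in> U" | "u \<in> U" "v = y" | "u \<in> U" "v \<in> U" using * by blast
    then show "1 / 4 < norm (u - v + k)"
    proof cases
      case 1
      then show ?thesis using int_lattice_norm_ge_1[of k] * by simp
    next
      case 2
      then show ?thesis using far[of v k] * by (simp add: algebra_simps)
    next
      case 3
      have "norm (u - v + k) = norm (y + - k - u)" 
        using 3 norm_minus_commute[of "u + k" y] by (simp add: algebra_simps)
      then show ?thesis using far[of u "- k"] 3 * uminus_in_int_lattice by metis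
    next
      case 4
      then show ?thesis using U * by (auto simp: periodic_packing_def)
    qed
  qed
  ultimately show False using no_ext by blast
qed

text \<open>
  The balls of radius \<open>1/4\<close> around a maximal packing cover every point, and they cover a small ball
  around \<open>m\<close> at least twice, because \<open>m\<close> is the midpoint of two centres at distance \<open>3/8\<close>. Hence the
  covering multiplicity has integral greater than \<open>1\<close> over the unit cell.
\<close>
lemma dense_periodic_packing:
  obtains U :: "(real ^ 'n) set" where "finite U" "periodic_packing U"
    "1 < card U * measure lborel (cball (0 :: real ^ 'n) (1 / 4))"
proof -
  obtain i :: 'n where True by simp
  define u\<^sub>0 m u\<^sub>1 :: "real ^ 'n" where "u\<^sub>0 = (\<chi> j. 1 / 2)"
    and "m = u\<^sub>0 + axis i (3 / 16)" and "u\<^sub>1 = m + axis i (3 / 16)"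
  have norm_axis: "norm (axis i c :: real ^ 'n) = \<bar>c\<bar>" for c
    by (simp add: norm_eq_sqrt_inner inner_axis_axis)
  note defs = u\<^sub>0_def u\<^sub>1_def m_def
  have ne: "u\<^sub>0 \<noteq> u\<^sub>1" by (auto simp: defs vec_eq_iff axis_def)
  have "periodic_packing {u\<^sub>0, u\<^sub>1}"
    unfolding periodic_packing_def
  proof (intro conjI ballI impI)
    show "{u\<^sub>0, u\<^sub>1} \<subseteq> unit_cell" by (auto simp: defs unit_cell_def axis_def)
    fix u v k assume *: "u \<in> {u\<^sub>0, u\<^sub>1}" "v \<in> {u\<^sub>0, u\<^sub>1}" "k \<in> int_lattice" "u - v + k \<noteq> 0"
    show "1 / 4 < norm (u - v + k)"
    proof (cases "u = v")
      case True
      then show ?thesis using int_lattice_norm_ge_1[of k] * by simp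
    next
      case False
      obtain z where z: "k $ i = of_int z" using *(3) by (auto simp: int_lattice_def elim: Ints_cases)
      \<comment> \<open>an integer plus \<open>3/8\<close> or \<open>-3/8\<close> has absolute value at least \<open>3/8\<close>\<close>
      have "(u - v) $ i = 3 / 8 \<or> (u - v) $ i = - 3 / 8"
        using * False by (auto simp: defs axis_def)
      then have "3 / 8 \<le> \<bar>(u - v + k) $ i\<bar>"
      proof
        assume "(u - v) $ i = 3 / 8"
        moreover have "z \<ge> 0 \<or> z \<le> -1" by linarith
        ultimately show ?thesis using z by auto
      next
        assume "(u - v) $ i = - 3 / 8"
        moreover have "z \<ge> 1 \<or> z \<le> 0" by linarith
        ultimately show ?thesis using z by auto
      qed
      then show ?thesis using component_le_norm_cart[of "u - v + k" i] by linarith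
    qed
  qed
  moreover obtain N where N: "\<And>U :: (real ^ 'n) set. periodic_packing U \<Longrightarrow> finite U \<and> card U \<le> N"
    using periodic_packing_card_bounded by blast
  ultimately have "\<exists>U. (periodic_packing U \<and> {u\<^sub>0, u\<^sub>1} \<subseteq> U) \<and>
      (\<forall>V. periodic_packing V \<and> {u\<^sub>0, u\<^sub>1} \<subseteq> V \<longrightarrow> card V \<le> card U)"
    by (intro ex_has_greatest_nat[of _ "{u\<^sub>0, u\<^sub>1}" _ "Suc N"]) (auto simp: less_Suc_eq_le)
  then obtain U where U: "periodic_packing U" "{u\<^sub>0, u\<^sub>1} \<subseteq> U"
    and max: "\<And>V. periodic_packing V \<Longrightarrow> {u\<^sub>0, u\<^sub>1} \<subseteq> V \<Longrightarrow> card V \<le> card U" by blast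
  have fin: "finite U" using N U(1) by blast
  have cover: "\<exists>u\<in>U. \<exists>k\<in>int_lattice. norm (y + k - u) \<le> 1 / 4" if "y \<in> unit_cell" for y
  proof (rule maximal_periodic_packing_covers[OF U(1) that])
    fix z assume "z \<notin> U"
    then show "\<not> periodic_packing (insert z U)" using max[of "insert z U"] U(2) fin by auto
  qed
  define f where "f = (\<lambda>x. \<Sum>u\<in>U. indicat_real (cball u (1 / 4)) x)"
  have ball_int: "integrable lborel (indicat_real (cball u (1 / 4)))" for u :: "real ^ 'n"
    by (intro integrable_real_indicator emeasure_bounded_finite) auto
  have f_int: "integrable lborel f" unfolding f_def using ball_int by simp
  have f_nonneg: "0 \<le> f x" for x unfolding f_def by (intro sum_nonneg) auto
  have f_norm: "norm x \<le> CARD('n) + 1" if "f x \<noteq> 0" for x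
  proof -
    have "\<exists>u\<in>U. indicat_real (cball u (1 / 4)) x \<noteq> 0"
      using that unfolding f_def by (meson sum.neutral)
    then obtain u where u: "u \<in> U" "dist u x \<le> 1 / 4"
      by (auto simp: indicator_def split: if_splits)
    then show ?thesis
      using norm_le_card_of_unit_cell[of u] U(1) norm_triangle_sub[of x u]
      by (auto simp: periodic_packing_def dist_norm norm_minus_commute)
  qed
  obtain K where K: "finite K" "K \<subseteq> (int_lattice :: (real ^ 'n) set)"
    "\<And>x k. norm x \<le> CARD('n) + 1 \<Longrightarrow> k \<in> int_lattice \<Longrightarrow> x - k \<in> unit_cell \<Longrightarrow> k \<in> K"
    using lattice_cover_of_bounded by metis
  have "\<forall>x. f x \<noteq> 0 \<longrightarrow> (\<exists>k\<in>K. x - k \<in> unit_cell)"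
    using K(3)[OF f_norm] unit_cell_representative by metis
  note unf = integral_unfold_lattice[OF f_int K(1,2) this]
  have term_le: "f (y + k) \<le> (\<Sum>k\<in>K. f (y + k))" if "k \<in> K" for y k
    using that K(1) f_nonneg by (intro member_le_sum) auto
  let ?W = "ball m (1 / 16)"
  have W_int: "integrable lborel (indicat_real ?W)"
    by (intro integrable_real_indicator emeasure_bounded_finite) auto
  have Q_int: "integrable lborel (indicat_real (unit_cell :: (real ^ 'n) set))"
    by (intro integrable_real_indicator) (auto simp: emeasure_unit_cell)
  have W_sub: "?W \<subseteq> unit_cell"
  proof
    fix x assume "x \<in> ?W"
    then have n: "norm (x - m) < 1 / 16" by (simp add: dist_norm norm_minus_commute)
    have "0 \<le> x $ j \<and> x $ j < 1" for j
    proof -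
      have "\<bar>x $ j - m $ j\<bar> < 1 / 16"
        using component_le_norm_cart[of "x - m" j] n by simp
      moreover have "m $ j = 1 / 2 \<or> m $ j = 11 / 16" by (auto simp: defs axis_def)
      ultimately show ?thesis by linarith
    qed
    then show "x \<in> unit_cell" by (simp add: unit_cell_def)
  qed
  \<comment> \<open>covering multiplicity: at least \<open>1\<close> everywhere and at least \<open>2\<close> on \<open>?W\<close>\<close>
  have lower: "indicator unit_cell y + indicator ?W y
      \<le> indicator unit_cell y *\<^sub>R (\<Sum>k\<in>K. f (y + k))" for y
  proof (cases "y \<in> unit_cell")
    case y: True
    show ?thesis
    proof (cases "y \<in> ?W")
      case True
      have "dist u\<^sub>0 m \<le> 3 / 16" "dist u\<^sub>1 m \<le> 3 / 16"
        by (simp_all add: u\<^sub>1_def m_def dist_norm norm_axis)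
      then have "dist u\<^sub>0 y \<le> 1 / 4" "dist u\<^sub>1 y \<le> 1 / 4"
        using True dist_triangle[of u\<^sub>0 y m] dist_triangle[of u\<^sub>1 y m] by auto
      then have "2 = (\<Sum>u\<in>{u\<^sub>0, u\<^sub>1}. indicat_real (cball u (1 / 4)) y)" using ne by simp
      also have "\<dots> \<le> f y" unfolding f_def using U(2) fin by (intro sum_mono2) auto
      finally have "2 \<le> f (y + 0)" by simp
      moreover have "0 \<in> K"
        using K(3)[of y 0] y norm_le_card_of_unit_cell[OF y] zero_in_int_lattice by simp
      ultimately show ?thesis using term_le[of 0 y] y True by simp
    next
      case False
      obtain u k where uk: "u \<in> U" "k \<in> int_lattice" "norm (y + k - u) \<le> 1 / 4"
        using cover[OF y] by blast
      have "1 = indicat_real (cball u (1 / 4)) (y + k)"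
        using uk(3) by (simp add: dist_norm norm_minus_commute)
      also have "\<dots> \<le> f (y + k)"
        unfolding f_def using uk(1) fin by (intro member_le_sum) auto
      finally have f1: "1 \<le> f (y + k)" .
      moreover have "k \<in> K" using K(3)[OF f_norm, of "y + k" k] f1 uk(2) y by simp
      ultimately show ?thesis using term_le[of k y] y False by simp
    qed
  qed (use W_sub in \<open>auto simp: indicator_def\<close>)
  have "1 < 1 + measure lborel ?W" by simp
  also have "\<dots> = (LINT y|lborel. indicat_real unit_cell y + indicat_real ?W y)"
    using Q_int W_int by (simp add: measure_def emeasure_unit_cell)
  also have "\<dots> \<le> (LINT y|lborel. indicator unit_cell y *\<^sub>R (\<Sum>k\<in>K. f (y + k)))"
    using Q_int W_int unf(1) lower by (intro integral_mono) auto
  also have "\<dots> = (LINT x|lborel. f x)" by (rule unf(2))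
  also have "\<dots> = (\<Sum>u\<in>U. measure lborel (cball u (1 / 4)))"
    unfolding f_def using ball_int by (subst Bochner_Integration.integral_sum) auto
  also have "\<dots> = card U * measure lborel (cball (0 :: real ^ 'n) (1 / 4))"
    by (simp add: content_cball)
  finally show ?thesis using that fin U(1) by blast
qed

section \<open>The volume of the unit ball in high dimension\<close>

lemma ln_1_plus_inverse_bounds:
  fixes x :: real assumes "x > 0"
  shows "x * (ln (x + 1) - ln x) \<le> 1" and "1 \<le> (x + 1) * (ln (x + 1) - ln x)"
proof -
  have "ln ((x + 1) / x) \<le> (x + 1) / x - 1" using assms by (intro ln_le_minus_one) auto
  then show "x * (ln (x + 1) - ln x) \<le> 1" using assms by (simp add: ln_div field_simps)
  have "ln (x / (x + 1)) \<le> x / (x + 1) - 1" using assms by (intro ln_le_minus_one) auto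
  then show "1 \<le> (x + 1) * (ln (x + 1) - ln x)" using assms by (simp add: ln_div field_simps)
qed

text \<open>
  The logarithm of \<open>\<Gamma>(x + 1) / (x/e)\<^sup>x\<close>.
\<close>
definition stirling_remainder :: "real \<Rightarrow> real" where
  "stirling_remainder x = ln (Gamma (x + 1)) - x * ln x + x"

text \<open>
  The increment is \<open>1 - x (ln (x + 1) - ln x)\<close>. It is nonnegative, and at most \<open>ln (x + 1) - ln x\<close>; thus
  the remainder increases, but no faster than the logarithm.
\<close>
lemma stirling_remainder_step:
  assumes "x > 0"
  shows "stirling_remainder x \<le> stirling_remainder (x + 1)"
    and "stirling_remainder (x + 1) - ln (x + 1) \<le> stirling_remainder x - ln x"
proof -
  have "Gamma (x + 1 + 1) = (x + 1) * Gamma (x + 1)"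
    using assms by (intro Gamma_plus1) (auto elim!: nonpos_Ints_cases)
  then have "ln (Gamma (x + 1 + 1)) = ln (x + 1) + ln (Gamma (x + 1))"
    using assms by (simp add: ln_mult Gamma_real_pos less_imp_neq[symmetric])
  then have *: "stirling_remainder (x + 1) - stirling_remainder x = 1 - x * (ln (x + 1) - ln x)"
    by (simp add: stirling_remainder_def algebra_simps)
  show "stirling_remainder x \<le> stirling_remainder (x + 1)"
    using * ln_1_plus_inverse_bounds(1)[OF assms] by linarith
  show "stirling_remainder (x + 1) - ln (x + 1) \<le> stirling_remainder x - ln x"
    using * ln_1_plus_inverse_bounds(2)[OF assms] by (simp add: algebra_simps)
qed

text \<open>
  In steps of \<open>2\<close> in \<open>n\<close> the argument \<open>n/2\<close> grows by \<open>1\<close>, so two starting values are needed.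
\<close>
lemma stirling_remainder_half_bounds:
  obtains a b where "\<And>n::nat. n > (0::nat) \<Longrightarrow> a \<le> stirling_remainder (n / 2)"
    and "\<And>n::nat. n > (0::nat) \<Longrightarrow> stirling_remainder (n / 2) \<le> b + ln (n / 2)"
proof -
  let ?g = "\<lambda>n::nat. stirling_remainder (n / 2)"
  let ?h = "\<lambda>n::nat. stirling_remainder (n / 2) - ln (n / 2)"
  have bounds: "min (?g 1) (?g 2) \<le> ?g n \<and> ?h n \<le> max (?h 1) (?h 2)" if "n > 0" for n
    using that
  proof (induction n rule: less_induct)
    case (less n)
    show ?case
    proof (cases "n \<le> 2")
      case True
      then have "n = 1 \<or> n = 2" using less.prems by linarith
      then show ?thesis by (elim disjE) auto
    next
      case False
      then obtain m where m: "n = m + 2" "m > 0"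
        using that[of "n - 2"] False by simp
      have e: "real n / 2 = real m / 2 + 1" using m by (simp add: field_simps)
      have "?g m \<le> ?g n" "?h n \<le> ?h m"
        unfolding e using stirling_remainder_step[of "real m / 2"] m by auto
      then show ?thesis using less.IH[of m] m by linarith
    qed
  qed
  show ?thesis
  proof (rule that)
    fix n :: nat assume n: "n > 0"
    show "min (?g 1) (?g 2) \<le> ?g n" using bounds[OF n] by (rule conjunct1)
    show "?g n \<le> max (?h 1) (?h 2) + ln (n / 2)" using bounds[OF n] by linarith
  qed
qed

lemma stirling_remainder_half_sublinear:
  "(\<lambda>n::nat. stirling_remainder (n / 2) / (n / 2)) \<longlonglongrightarrow> 0"
proof -
  obtain a b where ab: "\<And>n::nat. n > (0::nat) \<Longrightarrow> a \<le> stirling_remainder (n / 2)"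
    "\<And>n::nat. n > (0::nat) \<Longrightarrow> stirling_remainder (n / 2) \<le> b + ln (n / 2)"
    using stirling_remainder_half_bounds by blast
  show ?thesis
  proof (rule tendsto_sandwich)
    show "(\<lambda>n::nat. a / (n / 2)) \<longlonglongrightarrow> 0"
      using tendsto_mult_left[OF lim_1_over_n, of "2 * a"] by (simp add: mult.commute)
    have "(\<lambda>n::nat. 2 * (b - ln 2) * (1 / n) + 2 * (ln n / n)) \<longlonglongrightarrow> 2 * (b - ln 2) * 0 + 2 * 0"
      by (intro tendsto_intros)
    moreover have "\<forall>\<^sub>F n::nat in sequentially.
        2 * (b - ln 2) * (1 / n) + 2 * (ln n / n) = (b + ln (n / 2)) / (n / 2)"
      using eventually_gt_at_top[of "0::nat"] by eventually_elim (simp add: ln_div field_simps)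
    ultimately have "(\<lambda>n::nat. (b + ln (n / 2)) / (n / 2)) \<longlonglongrightarrow> 2 * (b - ln 2) * 0 + 2 * 0"
      by (rule Lim_transform_eventually)
    then show "(\<lambda>n::nat. (b + ln (n / 2)) / (n / 2)) \<longlonglongrightarrow> 0"
      by (simp only: mult_zero_right add_0_right)
    show "\<forall>\<^sub>F n::nat in sequentially. a / (n / 2) \<le> stirling_remainder (n / 2) / (n / 2)"
      using eventually_gt_at_top[of "0::nat"] by eventually_elim (intro divide_right_mono ab, auto)
    show "\<forall>\<^sub>F n::nat in sequentially. stirling_remainder (n / 2) / (n / 2) \<le> (b + ln (n / 2)) / (n / 2)"
      using eventually_gt_at_top[of "0::nat"] by eventually_elim (intro divide_right_mono ab, auto)
  qed
qed

lemma unit_ball_volume_eq_unit_ball_vol: "unit_ball_volume n = unit_ball_vol n"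
proof -
  have "{x \<in> space (Pi\<^sub>M {..<n} (\<lambda>_. lborel)). sqrt (\<Sum>i<n. (x i)\<^sup>2) \<le> (1::real)}
      = {f. sqrt (\<Sum>i<n. (f i)\<^sup>2) \<le> 1} \<inter> space (Pi\<^sub>M {..<n} (\<lambda>_. lborel))" by auto
  then show ?thesis
    using emeasure_cball_aux[of "{..<n}" 1] by (simp add: unit_ball_volume_def measure_def)
qed

text \<open>
  With \<open>x = n/2\<close> the left-hand side is \<open>2 \<Gamma>(x + 1)\<^bsup>1/x\<^esup>\<close>.
\<close>
lemma ball_volume_bound_eq_stirling:
  assumes "n \<ge> 1"
  shows "2 * pi / unit_ball_volume n powr (2 / n)
    = n / exp 1 * exp (stirling_remainder (n / 2) / (n / 2))"
proof -
  let ?x = "real n / 2"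
  let ?G = "Gamma (?x + 1)"
  have x: "?x > 0" using assms by simp
  then have G: "?G > 0" by (intro Gamma_real_pos) auto
  have "unit_ball_volume n powr (2 / n) = (pi powr ?x / ?G) powr (1 / ?x)"
    by (simp add: unit_ball_volume_eq_unit_ball_vol unit_ball_vol_def)
  also have "\<dots> = pi / ?G powr (1 / ?x)"
    using x G by (simp add: powr_divide powr_powr less_imp_le)
  finally have 1: "2 * pi / unit_ball_volume n powr (2 / n) = 2 * ?G powr (1 / ?x)"
    using G by (simp add: field_simps)
  have "stirling_remainder ?x / ?x = ln ?G / ?x - ln ?x + 1"
    using x by (simp add: stirling_remainder_def field_simps)
  then have "exp (stirling_remainder ?x / ?x) = ?G powr (1 / ?x) / ?x * exp 1"
    using x G[THEN less_imp_neq, symmetric] by (simp add: exp_add exp_diff powr_def)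
  then show ?thesis using 1 x by (simp add: field_simps)
qed

lemma ball_volume_bound_asymptotics:
  "\<exists>\<epsilon> :: nat \<Rightarrow> real. \<epsilon> \<longlonglongrightarrow> 0 \<and>
     (\<forall>n>1. 2 * pi / unit_ball_volume n powr (2 / real n) = real n / exp 1 * (1 + \<epsilon> n))"
proof (intro exI conjI allI impI)
  let ?\<epsilon> = "\<lambda>n::nat. exp (stirling_remainder (n / 2) / (n / 2)) - 1"
  show "?\<epsilon> \<longlonglongrightarrow> 0"
    using tendsto_diff[OF tendsto_exp[OF stirling_remainder_half_sublinear] tendsto_const[of 1]] by simp
  show "2 * pi / unit_ball_volume n powr (2 / real n) = real n / exp 1 * (1 + ?\<epsilon> n)" if "n > 1" for n
    using ball_volume_bound_eq_stirling[of n] that by simp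
qed

section \<open>Interpolation at periodic sets\<close>

lemma lborel_scale:
  fixes f :: "real ^ 'n \<Rightarrow> 'b :: {banach, second_countable_topology}"
  assumes c: "c \<noteq> 0" and [measurable]: "f \<in> borel_measurable borel"
  shows integrable_lborel_scale: "integrable lborel f \<Longrightarrow> integrable lborel (\<lambda>x. f (c *\<^sub>R x))"
    and integral_lborel_scale: "(LINT x|lborel. f x) = \<bar>c\<bar> ^ CARD('n) *\<^sub>R (LINT x|lborel. f (c *\<^sub>R x))"
proof -
  have d: "lborel = density (distr lborel borel (\<lambda>x :: real ^ 'n. c *\<^sub>R x)) (\<lambda>_. ennreal (\<bar>c\<bar> ^ CARD('n)))"
    using lborel_affine[OF c, of "0 :: real ^ 'n"] by (simp add: ennreal_power)
  show "integrable lborel (\<lambda>x. f (c *\<^sub>R x))" if "integrable lborel f"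
  proof -
    let ?a = "\<bar>c\<bar> ^ CARD('n)"
    have "integrable lborel (\<lambda>x. ?a *\<^sub>R f (c *\<^sub>R x))"
      using that by (subst (asm) d) (simp add: integrable_density integrable_distr_eq)
    then have "integrable lborel (\<lambda>x. (1 / ?a) *\<^sub>R (?a *\<^sub>R f (c *\<^sub>R x)))"
      by (rule integrable_scaleR_right)
    then show ?thesis using c by simp
  qed
  show "(LINT x|lborel. f x) = \<bar>c\<bar> ^ CARD('n) *\<^sub>R (LINT x|lborel. f (c *\<^sub>R x))"
    by (subst d) (simp add: integral_density integral_distr)
qed

lemma integrable_of_square_integrable_on_cball:
  fixes F :: "real ^ 'n \<Rightarrow> complex"
  assumes "square_integrable F"
  shows "integrable lborel (\<lambda>x. indicator (cball 0 1) x *\<^sub>R F x)"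
proof (rule Bochner_Integration.integrable_bound)
  have [measurable]: "F \<in> borel_measurable borel" using assms by (simp add: square_integrable_def)
  have "integrable lborel (indicat_real (cball (0 :: real ^ 'n) 1))"
    by (intro integrable_real_indicator emeasure_bounded_finite) auto
  then show "integrable lborel (\<lambda>x. indicat_real (cball 0 1) x + (norm (F x))\<^sup>2)"
    using assms by (simp add: square_integrable_def)
  have "t \<le> 1 + t\<^sup>2" if "t \<ge> 0" for t :: real
    using zero_le_power2[of "t - 1/2"] by (simp add: power2_eq_square algebra_simps)
  then show "AE x in lborel. norm (indicat_real (cball 0 1) x *\<^sub>R F x)
      \<le> norm (indicat_real (cball 0 1) x + (norm (F x))\<^sup>2)"
    by (auto simp: indicator_def intro!: AE_I2)
  show "(\<lambda>x. indicat_real (cball 0 1) x *\<^sub>R F x) \<in> borel_measurable lborel"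
    by (intro borel_measurable_scaleR borel_measurable_indicator) auto
qed

text \<open>
  Rescaling turns the values of \<open>f\<close> on \<open>2\<pi>\<rho>(U + \<int>\<^sup>n)\<close> into wave integrals with frequencies in
  \<open>U + \<int>\<^sup>n\<close>, at the price of enlarging the unit ball by the factor \<open>\<rho>\<close>. The function of the
  definition is only almost everywhere zero outside the ball, so it is cut off first.
\<close>
lemma paley_wiener_wave_representation:
  fixes f :: "real ^ 'n \<Rightarrow> complex"
  assumes f: "f \<in> paley_wiener (cball 0 1)" and \<rho>: "\<rho> > 0"
  obtains G where "integrable lborel G" "\<And>x. x \<notin> cball 0 \<rho> \<Longrightarrow> G x = 0"
    "\<And>t. f ((2 * pi * \<rho>) *\<^sub>R t) = (LINT x|lborel. wave t x * G x)"
proof -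
  obtain F where F: "square_integrable F" "AE x in lborel. x \<notin> cball 0 1 \<longrightarrow> F x = 0"
    and f_eq: "f = fourier_transform F"
    using f by (auto simp: paley_wiener_def)
  have [measurable]: "F \<in> borel_measurable borel" using F by (simp add: square_integrable_def)
  let ?n = "CARD('n)"
  define F' where "F' = (\<lambda>x. indicator (cball 0 1) x *\<^sub>R F x)"
  have F'_int: "integrable lborel F'"
    unfolding F'_def using F(1) by (rule integrable_of_square_integrable_on_cball)
  have [measurable]: "F' \<in> borel_measurable borel" using F'_int by simp
  define C where "C = (2 * pi) powr (- (real ?n / 2)) / \<rho> ^ ?n"
  define G where "G = (\<lambda>x. C *\<^sub>R F' ((1 / \<rho>) *\<^sub>R x))"
  show ?thesis
  proof (rule that[of G])
    show G_int: "integrable lborel G"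
      unfolding G_def using integrable_lborel_scale[of "1 / \<rho>" F'] F'_int \<rho> by simp
    show "G x = 0" if "x \<notin> cball 0 \<rho>" for x
      using that \<rho> by (simp add: G_def F'_def field_simps)
    fix t :: "real ^ 'n"
    have [measurable]: "G \<in> borel_measurable borel" using G_int by simp
    have G_scaled: "wave t (\<rho> *\<^sub>R x) * G (\<rho> *\<^sub>R x)
        = C *\<^sub>R (exp (- (\<i> * complex_of_real (((2 * pi * \<rho>) *\<^sub>R t) \<bullet> x))) * F' x)" for x
      using \<rho> by (simp add: G_def wave_def cis_conv_exp algebra_simps)
    have "(LINT x|lborel. wave t x * G x) = \<rho> ^ ?n *\<^sub>R (LINT x|lborel. wave t (\<rho> *\<^sub>R x) * G (\<rho> *\<^sub>R x))"
      using \<rho> integral_lborel_scale[of \<rho> "\<lambda>x. wave t x * G x"] by simp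
    also have "\<dots> = (\<rho> ^ ?n * C) *\<^sub>R
        (LINT x|lborel. exp (- (\<i> * complex_of_real (((2 * pi * \<rho>) *\<^sub>R t) \<bullet> x))) * F' x)"
      unfolding G_scaled by simp
    also have "(LINT x|lborel. exp (- (\<i> * complex_of_real (((2 * pi * \<rho>) *\<^sub>R t) \<bullet> x))) * F' x)
        = (LINT x|lborel. exp (- (\<i> * complex_of_real (((2 * pi * \<rho>) *\<^sub>R t) \<bullet> x))) * F x)"
    proof (rule integral_cong_AE)
      show "AE x in lborel. exp (- (\<i> * complex_of_real (((2 * pi * \<rho>) *\<^sub>R t) \<bullet> x))) * F' x
          = exp (- (\<i> * complex_of_real (((2 * pi * \<rho>) *\<^sub>R t) \<bullet> x))) * F x"
        using F(2) by eventually_elim (auto simp: F'_def indicator_def)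
    qed measurable
    also have "\<rho> ^ ?n * C = (2 * pi) powr (- (real ?n / 2))" using \<rho> by (simp add: C_def)
    finally show "f ((2 * pi * \<rho>) *\<^sub>R t) = (LINT x|lborel. wave t x * G x)"
      by (simp add: f_eq fourier_transform_def)
  qed
qed

lemma interpolation_set_delta:
  assumes "interpolation_set S \<Lambda>"
  obtains f where "f \<in> paley_wiener S" "\<And>l. l \<in> \<Lambda> \<Longrightarrow> f l = (if l = a then 1 else 0)"
proof -
  let ?c = "\<lambda>l. if l = a then 1 else 0 :: complex"
  have "(\<lambda>l. (norm (?c l))\<^sup>2) summable_on \<Lambda> \<longleftrightarrow> (\<lambda>l. (norm (?c l))\<^sup>2) summable_on (\<Lambda> \<inter> {a})"
    by (rule summable_on_cong_neutral) auto
  then have "(\<lambda>l. (norm (?c l))\<^sup>2) summable_on \<Lambda>" by simp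
  moreover have "(\<lambda>l. (norm (?c l))\<^sup>2) summable_on \<Lambda> \<longrightarrow>
      (\<exists>f\<in>paley_wiener S. \<forall>l\<in>\<Lambda>. f l = ?c l)"
    using assms unfolding interpolation_set_def by (elim conjE allE[of _ ?c])
  ultimately show ?thesis using that by blast
qed

text \<open>
  The interpolating functions for the unit data at the points of \<open>U\<close> form the biorthogonal family of
  \<open>card_le_measure_of_biorthogonal_waves\<close>.
\<close>
lemma periodic_interpolation_set_card_le:
  fixes U :: "(real ^ 'n) set"
  assumes U: "finite U" "U \<subseteq> unit_cell" and \<rho>: "\<rho> > 0"
    and int: "interpolation_set (cball 0 1)
      {(2 * pi * \<rho>) *\<^sub>R (u + k) | u k. u \<in> U \<and> k \<in> int_lattice}" (is "interpolation_set _ ?\<Lambda>")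
  shows "card U \<le> measure lborel (cball (0 :: real ^ 'n) \<rho>)"
proof -
  let ?L = "2 * pi * \<rho>"
  have L: "?L \<noteq> 0" using \<rho> by simp
  have "\<forall>u. \<exists>G. integrable lborel G \<and> (\<forall>x. x \<notin> cball 0 \<rho> \<longrightarrow> G x = 0) \<and>
      (\<forall>v\<in>U. \<forall>k\<in>int_lattice. (LINT x|lborel. wave (v + k) x * G x)
        = (if ?L *\<^sub>R (v + k) = ?L *\<^sub>R u then 1 else 0))"
  proof
    fix u
    obtain f where f: "f \<in> paley_wiener (cball 0 1)"
      "\<And>l. l \<in> ?\<Lambda> \<Longrightarrow> f l = (if l = ?L *\<^sub>R u then 1 else 0)"
      using interpolation_set_delta[OF int] by blast
    obtain G where G: "integrable lborel G" "\<And>x. x \<notin> cball 0 \<rho> \<Longrightarrow> G x = 0"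
      "\<And>t. f (?L *\<^sub>R t) = (LINT x|lborel. wave t x * G x)"
      using paley_wiener_wave_representation[OF f(1) \<rho>] by blast
    have "(LINT x|lborel. wave (v + k) x * G x) = (if ?L *\<^sub>R (v + k) = ?L *\<^sub>R u then 1 else 0)"
      if "v \<in> U" "k \<in> int_lattice" for v k
    proof -
      have "?L *\<^sub>R (v + k) \<in> ?\<Lambda>" using that by blast
      then show ?thesis using f(2) unfolding G(3)[symmetric] by blast
    qed
    then show "\<exists>G. integrable lborel G \<and> (\<forall>x. x \<notin> cball 0 \<rho> \<longrightarrow> G x = 0) \<and>
      (\<forall>v\<in>U. \<forall>k\<in>int_lattice. (LINT x|lborel. wave (v + k) x * G x)
        = (if ?L *\<^sub>R (v + k) = ?L *\<^sub>R u then 1 else 0))"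
      using G by blast
  qed
  from choice[OF this] obtain G where "\<forall>u. integrable lborel (G u) \<and> (\<forall>x. x \<notin> cball 0 \<rho> \<longrightarrow> G u x = 0) \<and>
      (\<forall>v\<in>U. \<forall>k\<in>int_lattice. (LINT x|lborel. wave (v + k) x * G u x)
        = (if ?L *\<^sub>R (v + k) = ?L *\<^sub>R u then 1 else 0))"
    by (elim exE)
  then have G: "integrable lborel (G u)" "x \<notin> cball 0 \<rho> \<Longrightarrow> G u x = 0"
    "v \<in> U \<Longrightarrow> k \<in> int_lattice \<Longrightarrow> (LINT x|lborel. wave (v + k) x * G u x)
        = (if ?L *\<^sub>R (v + k) = ?L *\<^sub>R u then 1 else 0)" for u v k x
    by blast+
  show ?thesis
  proof (rule card_le_measure_of_biorthogonal_waves[OF U(1), of "cball 0 \<rho>" \<rho> G])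
    fix u v k :: "real ^ 'n" assume *: "u \<in> U" "v \<in> U" "k \<in> int_lattice"
    have cell: "v \<in> unit_cell" "u \<in> unit_cell" using * U(2) by blast+
    have "?L *\<^sub>R (v + k) = ?L *\<^sub>R u \<longleftrightarrow> v + k = u" using L by simp
    also have "\<dots> \<longleftrightarrow> v = u \<and> k = 0"
      using unit_cell_representative_unique[OF cell(1), of k] cell(2) *(3) by auto
    finally show "(LINT x|lborel. wave (v + k) x * G u x) = (if v = u \<and> k = 0 then 1 else 0)"
      using G(3)[OF *(2,3), of u] by simp
  qed (use G in auto)
qed

text \<open>
  The choice \<open>\<rho> = 2r/\<pi>\<close> makes the period \<open>2\<pi>\<rho>\<close> equal to \<open>4r\<close>, so that a separation of \<open>1/4\<close> in the
  unit cell becomes a separation of \<open>r\<close>.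
\<close>
lemma separation_gt_of_all_interpolating:
  fixes r :: real
  assumes r: "r > 0"
    and int: "\<And>\<Lambda> :: (real ^ 'n) set. difference_set \<Lambda> \<inter> (\<lambda>x. r *\<^sub>R x) ` cball 0 1 = {0} \<Longrightarrow>
      interpolation_set (cball 0 1) \<Lambda>"
  shows "r > 2 * pi / measure lborel (cball 0 1 :: (real ^ 'n) set) powr (2 / real CARD('n))"
proof -
  let ?n = "CARD('n)"
  define V where "V = measure lborel (cball 0 1 :: (real ^ 'n) set)"
  have V: "V > 0" by (simp add: V_def)
  have ball: "measure lborel (cball 0 s :: (real ^ 'n) set) = V * s ^ ?n" if "s > 0" for s
    using that by (simp add: V_def content_cball)
  obtain U :: "(real ^ 'n) set" where U: "finite U" "periodic_packing U"
    "1 < card U * measure lborel (cball (0 :: real ^ 'n) (1 / 4))"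
    by (rule dense_periodic_packing)
  then have "U \<noteq> {}" by auto
  define \<rho> where "\<rho> = 2 * r / pi"
  have \<rho>: "\<rho> > 0" "2 * pi * \<rho> = 4 * r" using r by (simp_all add: \<rho>_def)
  let ?\<Lambda> = "{(2 * pi * \<rho>) *\<^sub>R (u + k) | u k. u \<in> U \<and> k \<in> int_lattice}"
  have "difference_set ?\<Lambda> \<inter> (\<lambda>x. r *\<^sub>R x) ` cball 0 1 = {0}"
  proof (intro equalityI subsetI)
    fix x assume x: "x \<in> difference_set ?\<Lambda> \<inter> (\<lambda>x. r *\<^sub>R x) ` cball 0 1"
    then obtain u v k l where uv: "u \<in> U" "v \<in> U" "k \<in> int_lattice" "l \<in> int_lattice"
      and x_eq: "x = (4 * r) *\<^sub>R (u + k) - (4 * r) *\<^sub>R (v + l)"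
      by (auto simp: difference_set_def \<rho>(2))
    have x_eq': "x = (4 * r) *\<^sub>R (u - v + (k - l))" unfolding x_eq by (simp add: algebra_simps)
    have "norm x \<le> r" using x r by (auto simp: mult_le_cancel_left1)
    then have "norm (u - v + (k - l)) \<le> 1 / 4" using r by (simp add: x_eq')
    then have "u - v + (k - l) = 0"
      using U(2) uv diff_in_int_lattice[of k l] unfolding periodic_packing_def by (metis not_le)
    then show "x \<in> {0}" by (simp add: x_eq')
  next
    fix x :: "real ^ 'n" assume "x \<in> {0}"
    moreover obtain u where "u \<in> U" using \<open>U \<noteq> {}\<close> by blast
    ultimately have "x = (2 * pi * \<rho>) *\<^sub>R (u + 0) - (2 * pi * \<rho>) *\<^sub>R (u + 0)"
      "(2 * pi * \<rho>) *\<^sub>R (u + 0) \<in> ?\<Lambda>" using zero_in_int_lattice by (simp, blast)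
    then have "x \<in> difference_set ?\<Lambda>" unfolding difference_set_def by blast
    moreover have "x \<in> (\<lambda>x. r *\<^sub>R x) ` cball 0 1"
      using \<open>x \<in> {0}\<close> by (intro image_eqI[of _ _ 0]) auto
    ultimately show "x \<in> difference_set ?\<Lambda> \<inter> (\<lambda>x. r *\<^sub>R x) ` cball 0 1" by blast
  qed
  from periodic_interpolation_set_card_le[OF U(1) _ \<rho>(1) int[OF this]] U(2)
  have N: "card U \<le> V * \<rho> ^ ?n" using \<rho> by (simp add: ball periodic_packing_def)
  have "1 < card U * (V * (1 / 4) ^ ?n)" using U(3) by (simp add: ball)
  also have "\<dots> \<le> V * \<rho> ^ ?n * (V * (1 / 4) ^ ?n)"
    using N V by (intro mult_right_mono) auto
  also have "\<dots> = V\<^sup>2 * (\<rho> * (1 / 4)) ^ ?n" unfolding power_mult_distrib by (simp add: power2_eq_square)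
  also have "\<rho> * (1 / 4) = r / (2 * pi)" by (simp add: \<rho>_def)
  finally have gt: "1 < V\<^sup>2 * (r / (2 * pi)) ^ ?n" .
  have "1 < (V\<^sup>2 * (r / (2 * pi)) ^ ?n) powr (1 / ?n)"
    using gt by (simp add: gr_one_powr)
  also have "\<dots> = (V powr 2) powr (1 / ?n) * ((r / (2 * pi)) powr ?n) powr (1 / ?n)"
    using V r by (simp add: powr_mult powr_realpow)
  also have "\<dots> = V powr (2 / ?n) * (r / (2 * pi))"
    using r by (simp add: powr_powr)
  finally show ?thesis
    using V by (simp add: field_simps flip: V_def)
qed

theorem corollary5p1:
  shows "(CARD('n) > 1 \<longrightarrow>
           (\<forall>r::real. r > 0 \<longrightarrow>
             (\<forall>\<Lambda> :: (real ^ 'n) set.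
                difference_set \<Lambda> \<inter> (\<lambda>x. r *\<^sub>R x) ` cball 0 1 = {0} \<longrightarrow>
                interpolation_set (cball 0 1) \<Lambda>) \<longrightarrow>
             r > 2 * pi / measure lborel (cball 0 1 :: (real ^ 'n) set) powr (2 / real CARD('n))))
         \<and>
         (\<exists>\<epsilon> :: nat \<Rightarrow> real. \<epsilon> \<longlonglongrightarrow> 0 \<and>
           (\<forall>n>1. 2 * pi / unit_ball_volume n powr (2 / real n) = real n / exp 1 * (1 + \<epsilon> n)))"
  using separation_gt_of_all_interpolating ball_volume_bound_asymptotics by blast

end
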